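(* Let $c>0$ and $p\in(0,1)$. Suppose the reward function $r$ is regular. For $x\ge 0$ put \[ M(x):=\left\lceil\frac{\ln(r'(x)/r'(0))}{\ln(1-p)}\right\rceil,\qquad \tilde M(x):=\left\lfloor\frac{\ln(r'(x)/r'(0))}{\ln(1-p)}\right\rfloor+1, \] \[ \eta(x):=\sum_{i=1}^{M(x)}\kappa_{1/(1-p)^{i-1}}(x). \] Then also $\eta(x)=\sum_{i=1}^{\tilde M(x)}\kappa_{1/(1-p)^{i-1}}(x)$ for all $x\ge0$, and the stationary policy $\omega(x)=\eta^{-1}(x)$, $x\in[0,c]$, is maximin optimal for $\mathcal{Q}_{c,p}$, and its associated least favorable distribution is Bernoulli, i.e. \[ \mathcal{T}(\omega,\tilde{\mathrm B}_p^{\otimes\infty})=\min_{Q\in\mathcal{Q}_{c,p}}\mathcal{T}(\omega,Q^{\otimes\infty}),\qquad \tilde{\mathrm B}_p:=(1-p)\delta_0+p\,\delta_c . \] In particular, if $r(u)=\frac12\ln(1+\gamma u)$ with $\gamma>0$, then the stationary policy \[ \omega_{\mathrm{AWGN}}(x)=\frac1\gamma\left[\frac{p(\gamma x+\tilde M)}{1-(1-p)^{\tilde M}}-1\right] \] is maximin optimal for $\mathcal{Q}_{c,p}$, where $\tilde M=\tilde M_x$ (for each $x$) is the least positive integer satisfying $[1+p(\gamma x+\tilde M)](1-p)^{\tilde M}<1$.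
   Context: Reward functions: a reward function is a nondecreasing, Lipschitz, concave function $r:[0,\infty)\to[0,\infty)$ with $r(0)=0$. ($r'(0)$ denotes the right derivative.) For strictly concave differentiable $r$ and $s>0$, write $\kappa_s(x):=(r')^{-1}(s\,r'(x))$ wherever this is defined (so $\kappa_1(x)=x$), and $\tau_s:=\kappa_{1/s}(0)=(r')^{-1}(r'(0)/s)$ for $s>1$. A reward function $r$ is regular if it is strictly concave and differentiable and, for every $s>1$ with $s\,r'(+\infty)<r'(0)$, the function $\kappa_s$ is convex on $[\tau_s,+\infty)$. Energy harvesting model: a battery has capacity $c>0$. The energy arriving at time $t=1,2,\dots$ is $x_t\ge0$. An online power control policy $\pi^\infty=(\pi_t)_{t\ge1}$ is a sequence of (measurable) maps giving the energy consumed in slot $t$, $u_t=\pi_t(x_1,\dots,x_t)\ge 0$. The battery levels before and after the arrival $x_t$ are $b_{t^-}$ and $b_t$, with $b_{1^-}=0$, $b_t=\min(b_{t^-}+x_t,c)$, $b_{(t+1)^-}=b_t-u_t$. The policy is admissible if $u_t\le b_t$ for all arrival sequences in $[0,\infty)^\infty$ and all $t$; $\Pi$ is the set of admissible policies. A stationary policy is a map $\sigma:[0,c]\to[0,c]$ with $\sigma(x)\le x$, identified with the admissible policy $u_t=\sigma(b_t)$. For a random arrival process $X^\infty$ with i.i.d. marginals $Q$ (law $Q^{\otimes\infty}$), the asymptotic expected average reward is $\mathcal{T}(\pi^\infty,Q^{\otimes\infty}):=\liminf_{n\to\infty}\mathbb{E}\big[\frac1n\sum_{t=1}^n r(U_t)\big]$,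 where $U_t$ is the energy consumed at time $t$ under $\pi^\infty$. For $p\in(0,1)$, $\mathcal{Q}_{c,p}$ is the set of Borel probability measures $Q$ on $[0,c]$ with $\frac1c\int x\,\mathrm{d}Q=p$. A policy $\hat\pi^\infty\in\Pi$ is maximin optimal for $\mathcal{Q}_{c,p}$ if $\inf_{Q\in\mathcal{Q}_{c,p}}\mathcal{T}(\hat\pi^\infty,Q^{\otimes\infty})=\sup_{\pi^\infty\in\Pi}\inf_{Q\in\mathcal{Q}_{c,p}}\mathcal{T}(\pi^\infty,Q^{\otimes\infty})$. $\delta_x$ is the unit point mass at $x$. An empty sum is $0$. *)

theory Defs
  imports "HOL-Probability.Probability"
begin

text \<open>Reward functions live on \<open>[0,\<infinity>)\<close>; they are represented by functions of type
  \<^typ>\<open>real \<Rightarrow> real\<close> whose values on negative arguments are irrelevant.\<close>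

definition reward_function :: "(real \<Rightarrow> real) \<Rightarrow> bool" where
  "reward_function r \<longleftrightarrow>
     (\<forall>x\<ge>0. 0 \<le> r x) \<and> mono_on {0..} r \<and> (\<exists>L. L-lipschitz_on {0..} r) \<and>
     concave_on {0..} r \<and> r 0 = 0"

definition strictly_concave_on :: "real set \<Rightarrow> (real \<Rightarrow> real) \<Rightarrow> bool" where
  "strictly_concave_on S f \<longleftrightarrow> convex S \<and>
     (\<forall>x\<in>S. \<forall>y\<in>S. x \<noteq> y \<longrightarrow>
        (\<forall>u>0. \<forall>v>0. u + v = 1 \<longrightarrow> u * f x + v * f y < f (u * x + v * y)))"

text \<open>The derivative within \<open>[0,\<infinity>)\<close>: the ordinary derivative at positive points and the right
  derivative at \<open>0\<close>.\<close>

definition rderiv :: "(real \<Rightarrow> real) \<Rightarrow> real \<Rightarrow> real" where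
  "rderiv r x = vector_derivative r (at x within {0..})"

text \<open>\<open>(r')\<^sup>-\<^sup>1(s r'(x))\<close> is meaningful only where \<open>s r'(x)\<close> is a value of \<open>r'\<close> on \<open>[0,\<infinity>)\<close>;
  for \<open>s > 1\<close> this means \<open>x \<ge> \<tau>\<^sub>s\<close> if \<open>s r'(+\<infinity>) < r'(0)\<close>, and holds nowhere otherwise.\<close>

definition kappa :: "(real \<Rightarrow> real) \<Rightarrow> real \<Rightarrow> real \<Rightarrow> real" where
  "kappa r s x = the_inv_into {0..} (rderiv r) (s * rderiv r x)"

definition tau :: "(real \<Rightarrow> real) \<Rightarrow> real \<Rightarrow> real" where
  "tau r s = kappa r (1 / s) 0"

definition regular_reward :: "(real \<Rightarrow> real) \<Rightarrow> bool" where
  "regular_reward r \<longleftrightarrow>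
     reward_function r \<and> strictly_concave_on {0..} r \<and> r differentiable_on {0..} \<and>
     (\<forall>s>1. s * Lim at_top (rderiv r) < rderiv r 0 \<longrightarrow> convex_on {tau r s..} (kappa r s))"

text \<open>Time slots are \<open>1,2,\<dots>\<close>; index \<open>0\<close> of an arrival sequence, a policy or a battery level is
  never used. The map \<open>\<pi>\<^sub>t\<close> is a function on the product space \<open>[0,\<infinity>)\<close> to the power \<open>{1..t}\<close>,
  so that \<open>\<pi>\<^sub>t(x\<^sub>1,\<dots>,x\<^sub>t)\<close> is obtained by restricting the arrival sequence to \<open>{1..t}\<close>.\<close>

type_synonym policy = "nat \<Rightarrow> (nat \<Rightarrow> real) \<Rightarrow> real"

definition consumption :: "policy \<Rightarrow> (nat \<Rightarrow> real) \<Rightarrow> nat \<Rightarrow> real" where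
  "consumption \<pi> x t = \<pi> t (restrict x {1..t})"

fun level_before :: "real \<Rightarrow> policy \<Rightarrow> (nat \<Rightarrow> real) \<Rightarrow> nat \<Rightarrow> real" where
  "level_before c \<pi> x 0 = 0"
| "level_before c \<pi> x (Suc 0) = 0"
| "level_before c \<pi> x (Suc (Suc n)) =
     min (level_before c \<pi> x (Suc n) + x (Suc n)) c - consumption \<pi> x (Suc n)"

definition level_after :: "real \<Rightarrow> policy \<Rightarrow> (nat \<Rightarrow> real) \<Rightarrow> nat \<Rightarrow> real" where
  "level_after c \<pi> x t = min (level_before c \<pi> x t + x t) c"

definition admissible_policies :: "real \<Rightarrow> policy set" where
  "admissible_policies c =
     {\<pi>. (\<forall>t\<ge>1. \<pi> t \<in> PiM {1..t} (\<lambda>_. restrict_space borel {0..}) \<rightarrow>\<^sub>M borel) \<and>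
         (\<forall>x. (\<forall>t\<ge>1. 0 \<le> x t) \<longrightarrow>
            (\<forall>t\<ge>1. 0 \<le> consumption \<pi> x t \<and> consumption \<pi> x t \<le> level_after c \<pi> x t))}"

definition is_stationary_rule :: "real \<Rightarrow> (real \<Rightarrow> real) \<Rightarrow> bool" where
  "is_stationary_rule c \<sigma> \<longleftrightarrow> (\<forall>b\<in>{0..c}. \<sigma> b \<in> {0..c} \<and> \<sigma> b \<le> b)"

text \<open>The policy \<open>u\<^sub>t = \<sigma>(b\<^sub>t)\<close>. As \<open>\<pi>\<^sub>t\<close> must be a function of the arrivals alone, the battery
  level \<open>b\<^sub>t\<close> that \<open>\<sigma>\<close> itself generates is computed by recursion along the arrivals.\<close>

fun stationary_level :: "real \<Rightarrow> (real \<Rightarrow> real) \<Rightarrow> (nat \<Rightarrow> real) \<Rightarrow> nat \<Rightarrow> real" where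
  "stationary_level c \<sigma> x 0 = 0"
| "stationary_level c \<sigma> x (Suc 0) = min (0 + x (Suc 0)) c"
| "stationary_level c \<sigma> x (Suc (Suc n)) =
     min (stationary_level c \<sigma> x (Suc n) - \<sigma> (stationary_level c \<sigma> x (Suc n)) + x (Suc (Suc n))) c"

definition stationary_policy :: "real \<Rightarrow> (real \<Rightarrow> real) \<Rightarrow> policy" where
  "stationary_policy c \<sigma> t x = \<sigma> (stationary_level c \<sigma> x t)"

lemma stationary_level_restrict:
  "stationary_level c \<sigma> (restrict x {1..t}) t = stationary_level c \<sigma> x t"
proof -
  have "n \<le> t \<Longrightarrow> stationary_level c \<sigma> (restrict x {1..t}) n = stationary_level c \<sigma> x n" for n
    by (induction n rule: stationary_level.induct[of _ c \<sigma> x]) auto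
  then show ?thesis by simp
qed

lemma consumption_stationary_policy:
  assumes "t \<ge> 1"
  shows "consumption (stationary_policy c \<sigma>) x t =
           \<sigma> (level_after c (stationary_policy c \<sigma>) x t)"
proof -
  let ?\<pi> = "stationary_policy c \<sigma>"
  have cons: "consumption ?\<pi> x n = \<sigma> (stationary_level c \<sigma> x n)" for n
    by (simp only: consumption_def stationary_policy_def stationary_level_restrict)
  have "level_after c ?\<pi> x (Suc n) = stationary_level c \<sigma> x (Suc n)" for n
    by (induction n) (simp_all add: level_after_def cons)
  then show ?thesis
    using assms cons by (cases t) auto
qed

definition iid_law :: "real measure \<Rightarrow> (nat \<Rightarrow> real) measure" where
  "iid_law Q = PiM {1..} (\<lambda>_. Q)"

definition average_reward :: "(real \<Rightarrow> real) \<Rightarrow> policy \<Rightarrow> (nat \<Rightarrow> real) measure \<Rightarrow> ereal" where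
  "average_reward r \<pi> P =
     liminf (\<lambda>n. ereal (\<integral>x. (1 / real n) * (\<Sum>t=1..n. r (consumption \<pi> x t)) \<partial>P))"

definition arrival_laws :: "real \<Rightarrow> real \<Rightarrow> real measure set" where
  "arrival_laws c p =
     {Q. prob_space Q \<and> sets Q = sets (restrict_space borel {0..c}) \<and> (1 / c) * (\<integral>x. x \<partial>Q) = p}"

definition worst_case_reward :: "(real \<Rightarrow> real) \<Rightarrow> real \<Rightarrow> real \<Rightarrow> policy \<Rightarrow> ereal" where
  "worst_case_reward r c p \<pi> = (INF Q\<in>arrival_laws c p. average_reward r \<pi> (iid_law Q))"

definition maximin_optimal :: "(real \<Rightarrow> real) \<Rightarrow> real \<Rightarrow> real \<Rightarrow> policy \<Rightarrow> bool" where
  "maximin_optimal r c p \<pi> \<longleftrightarrow>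
     \<pi> \<in> admissible_policies c \<and>
     worst_case_reward r c p \<pi> = (SUP \<pi>'\<in>admissible_policies c. worst_case_reward r c p \<pi>')"

definition scaled_bernoulli :: "real \<Rightarrow> real \<Rightarrow> real measure" where
  "scaled_bernoulli c p =
     (let B = restrict_space borel {0..c} in
      measure_of (space B) (sets B)
        (\<lambda>A. ennreal (1 - p) * emeasure (return B 0) A + ennreal p * emeasure (return B c) A))"

text \<open>The set function above is countably additive, so that \<^const>\<open>measure_of\<close> does not fall back
  to the null measure.\<close>

lemma emeasure_scaled_bernoulli:
  assumes "A \<in> sets (restrict_space borel {0..c})"
  shows "emeasure (scaled_bernoulli c p) A =
           ennreal (1 - p) * indicator A 0 + ennreal p * indicator A c"
proof -
  let ?B = "restrict_space borel {0..c}"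
  let ?m = "\<lambda>A. ennreal (1 - p) * emeasure (return ?B 0) A + ennreal p * emeasure (return ?B c) A"
  have "countably_additive (sets ?B) ?m"
  proof (rule countably_additiveI)
    fix F :: "nat \<Rightarrow> real set"
    assume F: "range F \<subseteq> sets ?B" "disjoint_family F"
    have "(\<Sum>i. emeasure (return ?B a) (F i)) = emeasure (return ?B a) (\<Union>i. F i)" for a
      using F by (intro suminf_emeasure) auto
    then show "(\<Sum>i. ?m (F i)) = ?m (\<Union>i. F i)"
      by (simp flip: suminf_add)
  qed
  then have "emeasure (scaled_bernoulli c p) A = ?m A"
    using assms unfolding scaled_bernoulli_def Let_def
    by (intro emeasure_measure_of_sigma sets.sigma_algebra_axioms) (auto simp: positive_def)
  with assms show ?thesis by simp
qed

definition M_ratio :: "(real \<Rightarrow> real) \<Rightarrow> real \<Rightarrow> real \<Rightarrow> real" where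
  "M_ratio r p x = ln (rderiv r x / rderiv r 0) / ln (1 - p)"

definition M_ceil :: "(real \<Rightarrow> real) \<Rightarrow> real \<Rightarrow> real \<Rightarrow> int" where
  "M_ceil r p x = \<lceil>M_ratio r p x\<rceil>"

definition M_tilde :: "(real \<Rightarrow> real) \<Rightarrow> real \<Rightarrow> real \<Rightarrow> int" where
  "M_tilde r p x = \<lfloor>M_ratio r p x\<rfloor> + 1"

definition eta :: "(real \<Rightarrow> real) \<Rightarrow> real \<Rightarrow> real \<Rightarrow> real" where
  "eta r p x = (\<Sum>i=1..nat (M_ceil r p x). kappa r (1 / (1 - p) ^ (i - 1)) x)"

definition omega :: "(real \<Rightarrow> real) \<Rightarrow> real \<Rightarrow> real \<Rightarrow> real" where
  "omega r p = the_inv_into {0..} (eta r p)"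

definition M_awgn :: "real \<Rightarrow> real \<Rightarrow> real \<Rightarrow> nat" where
  "M_awgn \<gamma> p x = (LEAST m. 0 < m \<and> (1 + p * (\<gamma> * x + real m)) * (1 - p) ^ m < 1)"

definition omega_awgn :: "real \<Rightarrow> real \<Rightarrow> real \<Rightarrow> real" where
  "omega_awgn \<gamma> p x =
     (1 / \<gamma>) * (p * (\<gamma> * x + real (M_awgn \<gamma> p x)) / (1 - (1 - p) ^ M_awgn \<gamma> p x) - 1)"

end

theory Submission
  imports Defs
begin

text \<open>Put \<open>q = 1 - p\<close> and let \<open>V b\<close> be the largest value of \<open>\<Sum>k. q\<^sup>k * r (u k)\<close> over nonnegative
  sequences with \<open>\<Sum>k. u k = b\<close>. The Lagrange conditions \<open>q\<^sup>k * r' (u k) = \<lambda>\<close> (or \<open>u k = 0\<close>) show that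
  the maximizer starts with \<open>u 0 = \<omega> b\<close> and that \<open>\<lambda> = r' (\<omega> b)\<close> is a supergradient of \<open>V\<close> at \<open>b\<close>.
  Hence \<open>V\<close> is concave and nondecreasing, and \<open>V b = max\<^sub>u (r u + q * V (b - u))\<close> is attained at
  \<open>u = \<omega> b\<close>. Under the Bernoulli law the expectation of \<open>V\<close> after the next arrival is
  \<open>q * V (b - u) + p * V c\<close>; under any other law with the same mean it is at least as large, by
  concavity. Telescoping over the slots, every admissible policy has average reward at most
  \<open>p * V c\<close> against the Bernoulli law, and \<open>\<omega>\<close> has average reward at least \<open>p * V c\<close> against every
  law.\<close>

section \<open>Strictly concave rewards\<close>

locale concave_reward =
  fixes r :: "real \<Rightarrow> real"
  assumes reward: "reward_function r"
    and strict: "strictly_concave_on {0..} r"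
    and differentiable: "r differentiable_on {0..}"
begin

abbreviation r' :: "real \<Rightarrow> real" where
  "r' \<equiv> rderiv r"

lemma reward_nonneg: "0 \<le> x \<Longrightarrow> 0 \<le> r x"
  and reward_mono: "mono_on {0..} r"
  and reward_0: "r 0 = 0"
  using reward by (auto simp: reward_function_def)

section \<open>Tangents and one-sided derivatives of a strictly concave reward\<close>

lemma has_derivative_rderiv:
  assumes "0 \<le> x"
  shows "(r has_real_derivative r' x) (at x within {0..})"
proof -
  have "r differentiable (at x within {0..})"
    using differentiable assms by (auto simp: differentiable_on_def)
  then show ?thesis
    unfolding rderiv_def has_real_derivative_iff_has_vector_derivative
    by (simp add: vector_derivative_works)
qed

text \<open>Concavity bounds the difference quotients along the segment from below by the increment
  \<open>r z - r x\<close>; their limit gives the weak inequality. Strict concavity at the midpoint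
  then upgrades it.\<close>

lemma below_tangent:
  assumes "0 \<le> x" "0 \<le> y" "x \<noteq> y"
  shows "r y < r x + r' x * (y - x)"
proof -
  have le: "r z \<le> r x + r' x * (z - x)" if "0 \<le> z" for z
  proof (cases "z = x")
    case False
    let ?\<phi> = "\<lambda>t. x + t * (z - x)"
    \<comment> \<open>On the segment from \<open>x\<close> to \<open>z\<close> only parameters in
      [0,1] occur, so a derivative within the half-line suffices even at
      \<open>x = 0\<close>.\<close>
    have "(?\<phi> has_real_derivative (z - x)) (at 0 within {0..1})"
      by (auto intro!: derivative_eq_intros)
    moreover have "(r has_real_derivative r' x) (at (?\<phi> 0) within ?\<phi> ` {0..1})"
    proof (rule DERIV_subset)
      show "(r has_real_derivative r' x) (at (?\<phi> 0) within {0..})"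
        using has_derivative_rderiv[OF assms(1)] by simp
      have "0 \<le> (1 - t) * x + t * z" if "t \<in> {0..1}" for t
        using assms(1) \<open>0 \<le> z\<close> that by simp
      then show "?\<phi> ` {0..1} \<subseteq> {0..}"
        by (auto simp: algebra_simps)
    qed
    ultimately have "((r \<circ> ?\<phi>) has_real_derivative r' x * (z - x)) (at 0 within {0..1})"
      by (rule DERIV_image_chain[rotated])
    then have lim: "((\<lambda>t. ((r \<circ> ?\<phi>) t - r x) / t) \<longlongrightarrow> r' x * (z - x)) (at 0 within {0..1})"
      by (simp add: has_field_derivative_iff)
    have "\<forall>\<^sub>F t in at 0 within {0..1}. r z - r x \<le> ((r \<circ> ?\<phi>) t - r x) / t"
    proof -
      have "r z - r x \<le> (r (?\<phi> t) - r x) / t" if t: "t \<noteq> 0" "0 \<le> t" "t \<le> 1" for t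
      proof -
        have "t * r z + (1 - t) * r x \<le> r (?\<phi> t)"
        proof (cases "t = 1")
          case False
          then have "t * r z + (1 - t) * r x < r (t * z + (1 - t) * x)"
            using strict t assms(1) \<open>0 \<le> z\<close> \<open>z \<noteq> x\<close> unfolding strictly_concave_on_def by auto
          then show ?thesis by (simp add: algebra_simps)
        qed simp
        then show ?thesis
          using t by (simp add: field_simps)
      qed
      then show ?thesis
        by (auto simp: eventually_at_filter intro!: always_eventually)
    qed
    moreover have "at (0::real) within {0..1} \<noteq> bot"
      by (simp add: at_within_Icc_at_right)
    ultimately have "r z - r x \<le> r' x * (z - x)"
      using tendsto_lowerbound[OF lim] by blast
    then show ?thesis by simp
  qed simp
  \<comment> \<open>The midpoint value is strictly above the chord and weakly below the tangent at
    \<open>x\<close>.\<close>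
  have "(1/2) * r x + (1/2) * r y < r ((1/2) * x + (1/2) * y)"
    using assms strict[unfolded strictly_concave_on_def, THEN conjunct2, rule_format,
        of x y "1/2" "1/2"] by simp
  moreover have "r ((1/2) * x + (1/2) * y) \<le> r x + r' x * ((1/2) * x + (1/2) * y - x)"
    using assms by (intro le) auto
  ultimately show ?thesis by (simp add: field_simps)
qed

lemma below_tangent_le:
  assumes "0 \<le> x" "0 \<le> y"
  shows "r y \<le> r x + r' x * (y - x)"
  using below_tangent[OF assms] by (cases "x = y") auto

text \<open>Adding the strict tangent inequalities at \<open>x\<close> and at \<open>y\<close>
  cancels the values of \<open>r\<close>.\<close>

lemma rderiv_strict_antimono:
  assumes "0 \<le> x" "x < y"
  shows "r' y < r' x"
proof -
  have "0 < (r' x - r' y) * (y - x)"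
    using below_tangent[of x y] below_tangent[of y x] assms by (simp add: algebra_simps)
  then show ?thesis
    using assms by (simp add: zero_less_mult_iff)
qed

lemma rderiv_antimono: "0 \<le> x \<Longrightarrow> x \<le> y \<Longrightarrow> r' y \<le> r' x"
  using rderiv_strict_antimono[of x y] by (cases "x = y") auto

lemma rderiv_less_iff: "0 \<le> x \<Longrightarrow> 0 \<le> y \<Longrightarrow> r' x < r' y \<longleftrightarrow> y < x"
  using rderiv_strict_antimono[of x y] rderiv_strict_antimono[of y x] by (cases x y rule: linorder_cases) auto

lemma rderiv_le_iff: "0 \<le> x \<Longrightarrow> 0 \<le> y \<Longrightarrow> r' x \<le> r' y \<longleftrightarrow> y \<le> x"
  using rderiv_less_iff[of y x] by (simp add: linorder_not_less[symmetric])

lemma inj_on_rderiv: "inj_on r' {0..}"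
proof (rule inj_onI)
  fix x y assume "x \<in> {0..}" "y \<in> {0..}" "r' x = r' y"
  then show "x = y"
    using rderiv_le_iff[of x y] rderiv_le_iff[of y x] by simp
qed

lemma rderiv_pos:
  assumes "0 \<le> x"
  shows "0 < r' x"
  using below_tangent[of x "x + 1"] mono_onD[OF reward_mono, of x "x + 1"] assms by simp

text \<open>The tangent at \<open>y\<close> dominates \<open>r\<close> at a point at distance
  \<open>h\<close> from \<open>x\<close>, where \<open>r\<close> is within \<open>e / 4 * h\<close>
  of the tangent at \<open>x\<close>. With \<open>y\<close> closer to \<open>x\<close> than
  \<open>h / 2\<close>, the two slopes differ by at most \<open>e / 2\<close>.\<close>

lemma continuous_on_rderiv: "continuous_on {0..} r'"
proof (subst continuous_on_iff, intro ballI allI impI)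
  fix x e :: real assume "x \<in> {0..}" "0 < e"
  then have x: "0 \<le> x" by simp
  have "\<exists>d>0. \<forall>y\<in>{0..}. norm (y - x) < d \<longrightarrow>
      norm (r y - r x - r' x * (y - x)) \<le> e / 4 * norm (y - x)"
    using has_derivative_rderiv[OF x] \<open>0 < e\<close> unfolding has_field_derivative_def
    by (auto simp: has_derivative_within_alt dest!: spec[of _ "e / 4"])
  then obtain d where "d > 0"
    and d: "\<And>y. 0 \<le> y \<Longrightarrow> \<bar>y - x\<bar> < d \<Longrightarrow> \<bar>r y - r x - r' x * (y - x)\<bar> \<le> e / 4 * \<bar>y - x\<bar>"
    by auto
  define h where "h = (if x = 0 then d / 2 else min (d / 2) x)"
  have h: "0 < h" "h < d" "x = 0 \<or> h \<le> x"
    using \<open>d > 0\<close> x by (auto simp: h_def)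
  have "\<bar>r' y - r' x\<bar> < e" if y: "0 \<le> y" "\<bar>y - x\<bar> < h / 2" for y
  proof -
    have 1: "r y \<le> r x + r' x * (y - x)"
      using below_tangent_le x y by blast
    have "r' x - r' y \<le> e / 2"
    proof (cases "x \<le> y")
      case True
      have "r (x + h) \<le> r y + r' y * (x + h - y)"
        using below_tangent_le[of y "x + h"] x y h by simp
      moreover have "r x + r' x * h - e / 4 * h \<le> r (x + h)"
        using d[of "x + h"] x h unfolding add_diff_cancel_left' by linarith
      ultimately have "(r' x - r' y) * (h - (y - x)) \<le> e / 4 * h"
        using 1 by (simp add: algebra_simps)
      moreover have "(r' x - r' y) * (h / 2) \<le> (r' x - r' y) * (h - (y - x))"
        using rderiv_antimono[OF x True] y by (intro mult_left_mono) linarith+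
      ultimately have "(r' x - r' y) * h \<le> (e / 2) * h"
        by (simp add: algebra_simps)
      then show ?thesis using h by simp
    next
      case False
      then show ?thesis
        using rderiv_antimono[of y x] y \<open>0 < e\<close> by simp
    qed
    moreover have "r' y - r' x \<le> e / 2"
    proof (cases "x \<le> y")
      case True
      then show ?thesis
        using rderiv_antimono[of x y] x \<open>0 < e\<close> by simp
    next
      case False
      then have hx: "h \<le> x" using h y by auto
      have "r (x - h) \<le> r y + r' y * (x - h - y)"
        using below_tangent_le[of y "x - h"] y hx by simp
      moreover have "\<bar>r (x - h) - r x + r' x * h\<bar> \<le> e / 4 * h"
        using d[of "x - h"] hx h by simp
      then have "r x - r' x * h - e / 4 * h \<le> r (x - h)"
        by linarith
      ultimately have "(r' y - r' x) * (h - (x - y)) \<le> e / 4 * h"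
        using 1 by (simp add: algebra_simps)
      moreover have "(r' y - r' x) * (h / 2) \<le> (r' y - r' x) * (h - (x - y))"
        using rderiv_antimono[of y x] y False by (intro mult_left_mono) linarith+
      ultimately have "(r' y - r' x) * h \<le> (e / 2) * h"
        by (simp add: algebra_simps)
      then show ?thesis using h by simp
    qed
    ultimately show ?thesis using \<open>0 < e\<close> by linarith
  qed
  then show "\<exists>d>0. \<forall>y\<in>{0..}. dist y x < d \<longrightarrow> dist (r' y) (r' x) < e"
    using h by (intro exI[of _ "h / 2"]) (auto simp: dist_real_def)
qed

lemma rderiv_surj:
  assumes "0 \<le> x" "r' x \<le> v" "v \<le> r' 0"
  obtains u where "0 \<le> u" "u \<le> x" "r' u = v"
  using IVT2'[of r' x v 0] assms continuous_on_subset[OF continuous_on_rderiv, of "{0..x}"] by auto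

end

section \<open>Optimal discounted allocation of a budget\<close>

locale discounted_reward = concave_reward +
  fixes p :: real
  assumes p: "0 < p" "p < 1"
begin

abbreviation q :: real where
  "q \<equiv> 1 - p"

lemma power_q_pos: "0 < q ^ k"
  using p by simp

text \<open>The \<open>k\<close>-th summand of \<^const>\<open>eta\<close>, extended by \<open>0\<close> to those \<open>k\<close> for which \<^const>\<open>kappa\<close>
  is a junk value. This makes the number of summands immaterial once it is large enough.\<close>

definition share :: "nat \<Rightarrow> real \<Rightarrow> real" where
  "share k x = the_inv_into {0..} r' (min (r' 0) (r' x / q ^ k))"

text \<open>The clipped value lies between \<open>r' x\<close> and \<open>r' 0\<close>, so the
  intermediate value property of \<open>r'\<close> yields a preimage in
  \<open>{0..x}\<close>.\<close>

lemma
  assumes "0 \<le> x"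
  shows share_nonneg: "0 \<le> share k x" and share_le: "share k x \<le> x"
    and rderiv_share: "r' (share k x) = min (r' 0) (r' x / q ^ k)"
proof -
  have "r' x * q ^ k \<le> r' x * 1"
    using rderiv_pos[OF assms] p by (intro mult_left_mono power_le_one) auto
  then have "r' x \<le> r' x / q ^ k"
    using power_q_pos[of k] by (simp add: field_simps)
  then obtain u where u: "0 \<le> u" "u \<le> x" "r' u = min (r' 0) (r' x / q ^ k)"
    using rderiv_surj[OF assms, of "min (r' 0) (r' x / q ^ k)"] rderiv_antimono[of 0 x] assms by auto
  then have "share k x = u"
    unfolding share_def by (intro the_inv_into_f_eq inj_on_rderiv) auto
  with u show "0 \<le> share k x" "share k x \<le> x" "r' (share k x) = min (r' 0) (r' x / q ^ k)"
    by auto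
qed

lemma share_eqI:
  assumes "0 \<le> u" "r' u = min (r' 0) (r' x / q ^ k)"
  shows "share k x = u"
  unfolding share_def using assms by (intro the_inv_into_f_eq inj_on_rderiv) auto

lemma share_0: "0 \<le> x \<Longrightarrow> share 0 x = x"
  using rderiv_antimono[of 0 x] by (intro share_eqI) auto

text \<open>The optimal sequence for the energy left after the first slot is the tail of
  the optimal sequence.\<close>

lemma share_share:
  assumes "0 \<le> x"
  shows "share k (share (Suc 0) x) = share (Suc k) x"
proof (rule share_eqI)
  \<comment> \<open>Clipping at \<open>r' 0\<close> before dividing by \<open>q ^ k\<close> is
    harmless: \<open>r' 0 / q ^ k\<close> is clipped again anyway.\<close>
  have "r' 0 * q ^ k \<le> r' 0 * 1"
    using rderiv_pos[of 0] p by (intro mult_left_mono power_le_one) auto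
  then have "r' 0 \<le> r' 0 / q ^ k"
    using power_q_pos[of k] by (simp add: field_simps)
  then show "r' (share (Suc k) x) = min (r' 0) (r' (share (Suc 0) x) / q ^ k)"
    using power_q_pos[of k]
    by (simp add: rderiv_share[OF assms] min_divide_distrib_right min.absorb1 mult.commute flip: min.assoc)
qed (use share_nonneg assms in auto)

lemma share_mono:
  assumes "0 \<le> x" "x \<le> y"
  shows "share k x \<le> share k y"
proof -
  have "r' (share k y) \<le> r' (share k x)"
    using assms rderiv_antimono[OF assms] power_q_pos[of k]
    by (simp add: rderiv_share min.coboundedI2 divide_right_mono)
  then show ?thesis
    using rderiv_le_iff[of "share k y" "share k x"] share_nonneg assms by simp
qed

lemma share_eq_0_iff:
  assumes "0 \<le> x"
  shows "share k x = 0 \<longleftrightarrow> q ^ k * r' 0 \<le> r' x"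
proof -
  have "share k x = 0 \<longleftrightarrow> r' 0 \<le> r' (share k x)"
    using rderiv_le_iff[of 0 "share k x"] share_nonneg[OF assms, of k] by auto
  then show ?thesis
    using power_q_pos[of k] by (simp add: rderiv_share[OF assms] pos_le_divide_eq mult.commute)
qed

section \<open>Writing \<open>eta\<close> as a finite sum of shares\<close>

lemma share_eq_kappa:
  assumes "0 \<le> x" "r' x \<le> q ^ k * r' 0"
  shows "share k x = kappa r (1 / q ^ k) x"
proof -
  have "r' x / q ^ k \<le> r' 0"
    using assms power_q_pos[of k] by (simp add: pos_divide_le_eq mult.commute)
  then show ?thesis by (simp add: share_def kappa_def min_def)
qed

text \<open>Compactness of \<open>{0..X}\<close> makes the inverse of \<open>r'\<close> continuous
  on the image; since shares never exceed \<open>x\<close>, the clipped values stay in that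
  image.\<close>

lemma continuous_on_share: "continuous_on {0..X} (share k)"
proof (cases "0 \<le> X")
  case True
  have sub: "continuous_on {0..X} r'"
    by (rule continuous_on_subset[OF continuous_on_rderiv]) auto
  have "continuous_on (r' ` {0..X}) (the_inv_into {0..} r')"
    by (rule continuous_on_inv[OF sub]) (auto intro!: the_inv_into_f_f inj_on_rderiv)
  moreover have "continuous_on {0..X} (\<lambda>x. min (r' 0) (r' x / q ^ k))"
    using p by (intro continuous_intros sub) auto
  moreover have "(\<lambda>x. min (r' 0) (r' x / q ^ k)) ` {0..X} \<subseteq> r' ` {0..X}"
  proof (intro image_subsetI)
    fix x assume "x \<in> {0..X}"
    then show "min (r' 0) (r' x / q ^ k) \<in> r' ` {0..X}"
      using share_nonneg[of x k] share_le[of x k] by (intro image_eqI[of _ _ "share k x"]) (auto simp: rderiv_share)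
  qed
  ultimately have "continuous_on {0..X} (\<lambda>x. the_inv_into {0..} r' (min (r' 0) (r' x / q ^ k)))"
    by (rule continuous_on_compose2)
  then show ?thesis
    unfolding share_def[abs_def] .
qed simp

text \<open>All shares from index \<open>m\<close> or \<open>n\<close> on vanish. The general
  \<open>f\<close> serves both the energy \<open>u\<close> and the discounted reward
  \<open>q ^ k * r u\<close>.\<close>

lemma sum_share_cong:
  assumes "0 \<le> x" "q ^ m * r' 0 \<le> r' x" "q ^ n * r' 0 \<le> r' x" and "\<And>k. f k 0 = 0"
  shows "(\<Sum>k<m. f k (share k x)) = (\<Sum>k<n. f k (share k x))"
proof -
  have le: "(\<Sum>k<m. f k (share k x)) = (\<Sum>k<n. f k (share k x))"
    if "m \<le> n" "q ^ m * r' 0 \<le> r' x" for m n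
  proof (rule sum.mono_neutral_left)
    show "\<forall>k\<in>{..<n} - {..<m}. f k (share k x) = 0"
    proof
      fix k assume "k \<in> {..<n} - {..<m}"
      then have "q ^ k * r' 0 \<le> q ^ m * r' 0"
        using p rderiv_pos[of 0] by (intro mult_right_mono power_decreasing) auto
      then have "share k x = 0"
        using that share_eq_0_iff[OF assms(1)] by simp
      then show "f k (share k x) = 0" by (simp add: assms(4))
    qed
  qed (use that in auto)
  show ?thesis
    using le[OF _ assms(2)] le[OF _ assms(3)] nat_le_linear by metis
qed

text \<open>Since \<open>q ^ k\<close> decreases in \<open>k\<close>, the condition at the last
  index makes every earlier \<open>kappa\<close> meaningful. The case \<open>m = 0\<close> is
  separate because \<open>m - 1\<close> is truncated there.\<close>

lemma sum_kappa_eq_sum_share: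
  assumes "0 \<le> x" "m = 0 \<or> r' x \<le> q ^ (m - 1) * r' 0"
  shows "(\<Sum>i=1..m. kappa r (1 / q ^ (i - 1)) x) = (\<Sum>k<m. share k x)"
proof -
  have "kappa r (1 / q ^ k) x = share k x" if "k < m" for k
  proof (rule share_eq_kappa[symmetric])
    have "q ^ (m - 1) * r' 0 \<le> q ^ k * r' 0"
      using p rderiv_pos[of 0] that by (intro mult_right_mono power_decreasing) auto
    then show "r' x \<le> q ^ k * r' 0" using assms(2) that by linarith
  qed fact
  moreover have "(\<Sum>i=1..m. kappa r (1 / q ^ (i - 1)) x) = (\<Sum>k<m. kappa r (1 / q ^ k) x)"
    by (rule sum.reindex_bij_witness[of _ Suc "\<lambda>i. i - 1"]) auto
  ultimately show ?thesis by simp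
qed

text \<open>Division by \<open>ln q < 0\<close> reverses the order. Together the two equivalences
  locate the index from which the shares vanish and the indices at which \<open>kappa\<close> is
  meaningful.\<close>

lemma M_ratio_le_iff:
  assumes "0 \<le> x"
  shows "M_ratio r p x \<le> real k \<longleftrightarrow> q ^ k * r' 0 \<le> r' x"
    and "real k \<le> M_ratio r p x \<longleftrightarrow> r' x \<le> q ^ k * r' 0"
proof -
  have pos: "0 < r' x / r' 0" "0 < r' 0" "ln q < 0"
    using rderiv_pos[of 0] rderiv_pos[OF assms] p by auto
  have "M_ratio r p x \<le> real k \<longleftrightarrow> ln (q ^ k) \<le> ln (r' x / r' 0)"
    using pos p by (simp add: M_ratio_def neg_divide_le_eq ln_realpow)
  also have "\<dots> \<longleftrightarrow> q ^ k \<le> r' x / r' 0"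
    using pos power_q_pos by (intro ln_le_cancel_iff)
  finally show "M_ratio r p x \<le> real k \<longleftrightarrow> q ^ k * r' 0 \<le> r' x"
    using pos by (simp add: pos_le_divide_eq)
  have "real k \<le> M_ratio r p x \<longleftrightarrow> ln (r' x / r' 0) \<le> ln (q ^ k)"
    using pos p by (simp add: M_ratio_def neg_le_divide_eq ln_realpow)
  also have "\<dots> \<longleftrightarrow> r' x / r' 0 \<le> q ^ k"
    using pos power_q_pos by (intro ln_le_cancel_iff)
  finally show "real k \<le> M_ratio r p x \<longleftrightarrow> r' x \<le> q ^ k * r' 0"
    using pos by (simp add: pos_divide_le_eq)
qed

text \<open>The free \<open>n\<close> allows one common number of terms for \<open>eta\<close> at
  many points, although the ceiling varies with the point.\<close>

lemma eta_eq_sum_share: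
  assumes "0 \<le> x" "q ^ n * r' 0 \<le> r' x"
  shows "eta r p x = (\<Sum>k<n. share k x)"
proof -
  let ?m = "nat (M_ceil r p x)"
  have "M_ratio r p x \<le> real ?m" "?m = 0 \<or> real (?m - 1) \<le> M_ratio r p x"
    unfolding M_ceil_def by linarith+
  then have "q ^ ?m * r' 0 \<le> r' x" and m: "?m = 0 \<or> r' x \<le> q ^ (?m - 1) * r' 0"
    using M_ratio_le_iff[OF assms(1)] by blast+
  moreover have "eta r p x = (\<Sum>k<?m. share k x)"
    unfolding eta_def by (rule sum_kappa_eq_sum_share[OF assms(1) m])
  ultimately show ?thesis
    using sum_share_cong[of x ?m n "\<lambda>_ u. u"] assms by simp
qed

text \<open>Floor plus one exceeds the ceiling only when \<open>M_ratio r p x\<close> is an integer,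
  and then the extra term is a share exactly at its threshold, hence 0.\<close>

lemma eta_eq_sum_M_tilde:
  assumes "0 \<le> x"
  shows "eta r p x = (\<Sum>i=1..nat (M_tilde r p x). kappa r (1 / q ^ (i - 1)) x)"
proof -
  let ?m = "nat (M_tilde r p x)"
  have "M_ratio r p x \<le> real ?m" "?m = 0 \<or> real (?m - 1) \<le> M_ratio r p x"
    unfolding M_tilde_def by linarith+
  then have le: "q ^ ?m * r' 0 \<le> r' x" and m: "?m = 0 \<or> r' x \<le> q ^ (?m - 1) * r' 0"
    using M_ratio_le_iff[OF assms(1)] by blast+
  show ?thesis
    unfolding sum_kappa_eq_sum_share[OF assms m] by (rule eta_eq_sum_share[OF assms le])
qed

text \<open>The form \<open>Suc n\<close> ensures a term of index 0, which is \<open>x\<close>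
  itself and can be split off.\<close>

lemma ex_horizon:
  assumes "0 \<le> x"
  obtains n where "q ^ Suc n * r' 0 \<le> r' x"
proof -
  obtain n where "q ^ n < r' x / r' 0"
    using real_arch_pow_inv[of "r' x / r' 0" q] rderiv_pos[of 0] rderiv_pos[OF assms] p by auto
  then have "q ^ n * r' 0 \<le> r' x"
    using rderiv_pos[of 0] by (simp add: pos_less_divide_eq)
  moreover have "q ^ Suc n * r' 0 \<le> q ^ n * r' 0"
    using p rderiv_pos[of 0] by (intro mult_right_mono power_decreasing) auto
  ultimately show thesis by (intro that[of n]) linarith
qed

lemma eta_eq_Suc_sum_share:
  assumes "0 \<le> x" "q ^ Suc n * r' 0 \<le> r' x"
  shows "eta r p x = x + (\<Sum>k<n. share (Suc k) x)"
  unfolding eta_eq_sum_share[OF assms] sum.lessThan_Suc_shift share_0[OF assms(1)] by simp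

section \<open>The bijection \<open>eta\<close> of the half-line and its inverse
  \<open>omega\<close>\<close>

lemma eta_strict_mono:
  assumes "0 \<le> x" "x < y"
  shows "eta r p x < eta r p y"
proof -
  obtain n where n: "q ^ Suc n * r' 0 \<le> r' y"
    using ex_horizon[of y] assms by auto
  then have "q ^ Suc n * r' 0 \<le> r' x"
    using rderiv_antimono[of x y] assms by linarith
  then have "eta r p x = x + (\<Sum>k<n. share (Suc k) x)" "eta r p y = y + (\<Sum>k<n. share (Suc k) y)"
    using n assms by (auto intro: eta_eq_Suc_sum_share)
  \<comment> \<open>The later shares are only weakly monotone; strictness comes from the leading
    term.\<close>
  moreover have "(\<Sum>k<n. share (Suc k) x) \<le> (\<Sum>k<n. share (Suc k) y)"
    using assms by (intro sum_mono share_mono) auto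
  ultimately show ?thesis using assms by simp
qed

lemma eta_ge:
  assumes "0 \<le> x"
  shows "x \<le> eta r p x"
proof -
  obtain n where "q ^ Suc n * r' 0 \<le> r' x"
    using ex_horizon[OF assms] by auto
  then have "eta r p x = x + (\<Sum>k<n. share (Suc k) x)"
    using assms by (auto intro: eta_eq_Suc_sum_share)
  then show ?thesis using share_nonneg assms by (simp add: sum_nonneg)
qed

lemma eta_0: "eta r p 0 = 0"
  using eta_eq_sum_share[of 0 0] by simp

text \<open>Existence is the intermediate value theorem on \<open>{0..y}\<close>, because
  \<open>eta\<close> vanishes at 0 and is at least \<open>y\<close> at \<open>y\<close>; uniqueness
  is strict monotonicity.\<close>

lemma eta_bij_ex1:
  assumes "0 \<le> y"
  shows "\<exists>!x. x \<in> {0..} \<and> eta r p x = y"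
proof -
  obtain n where n: "q ^ Suc n * r' 0 \<le> r' y"
    using ex_horizon[OF assms] by auto
  \<comment> \<open>A horizon for \<open>y\<close> works for all smaller points, so
    \<open>eta\<close> is here a single finite sum of continuous shares.\<close>
  have "continuous_on {0..y} (eta r p) \<longleftrightarrow> continuous_on {0..y} (\<lambda>x. \<Sum>k<Suc n. share k x)"
  proof (rule continuous_on_cong)
    fix x assume "x \<in> {0..y}"
    then show "eta r p x = (\<Sum>k<Suc n. share k x)"
      using n rderiv_antimono[of x y] by (intro eta_eq_sum_share) auto
  qed simp
  then have "continuous_on {0..y} (eta r p)"
    by (simp only: continuous_on_sum continuous_on_share)
  then obtain x where "0 \<le> x" "eta r p x = y"
    using IVT'[of "eta r p" 0 y y] eta_0 eta_ge assms by auto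
  moreover have "x' = x" if "0 \<le> x'" "eta r p x' = eta r p x" "0 \<le> x" for x x'
    using that eta_strict_mono[of x x'] eta_strict_mono[of x' x]
    by (cases x x' rule: linorder_cases) auto
  ultimately show ?thesis by auto
qed

lemma
  assumes "0 \<le> y"
  shows omega_nonneg: "0 \<le> omega r p y" and eta_omega: "eta r p (omega r p y) = y"
    and omega_le: "omega r p y \<le> y"
proof -
  obtain x where x: "0 \<le> x" "eta r p x = y"
    using eta_bij_ex1[OF assms] by auto
  have "inj_on (eta r p) {0..}"
    using eta_bij_ex1 eta_ge by (intro inj_onI) (metis atLeast_iff order_trans)
  then have "omega r p y = x"
    unfolding omega_def using x by (intro the_inv_into_f_eq) auto
  then show "0 \<le> omega r p y" "eta r p (omega r p y) = y" "omega r p y \<le> y"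
    using x eta_ge[of x] by auto
qed

lemma omega_eqI:
  assumes "0 \<le> x" "eta r p x = y"
  shows "omega r p y = x"
  using eta_bij_ex1[of y] omega_nonneg[of y] eta_omega[of y] eta_ge[of x] assms by auto

lemma omega_mono:
  assumes "0 \<le> x" "x \<le> y"
  shows "omega r p x \<le> omega r p y"
  using eta_strict_mono[of "omega r p y" "omega r p x"] omega_nonneg eta_omega assms
  by (metis linorder_not_less order_trans)

text \<open>Lagrangian duality: at the multiplier \<open>r'(x)\<close> of the budget constraint, the sequence
  \<open>share k x\<close> maximizes the discounted reward term by term.\<close>

lemma weighted_share_optimal:
  assumes "0 \<le> x" and u: "\<And>k. 0 \<le> u k"
  shows "(\<Sum>k<n. q ^ k * r (u k)) \<le>
    (\<Sum>k<n. q ^ k * r (share k x)) + r' x * ((\<Sum>k<n. u k) - (\<Sum>k<n. share k x))"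
proof -
  have "q ^ k * r (u k) \<le> q ^ k * r (share k x) + r' x * (u k - share k x)" for k
  proof -
    have "q ^ k * r (u k) \<le> q ^ k * (r (share k x) + r' (share k x) * (u k - share k x))"
      using below_tangent_le share_nonneg assms power_q_pos[of k] by (intro mult_left_mono) auto
    moreover have "q ^ k * r' (share k x) * (u k - share k x) \<le> r' x * (u k - share k x)"
    proof (cases "q ^ k * r' 0 \<le> r' x")
      case True
      then have "share k x = 0" using share_eq_0_iff assms by blast
      with True show ?thesis using u[of k] by (simp add: mult_right_mono)
    next
      case False
      then have "r' (share k x) = r' x / q ^ k"
        using power_q_pos[of k]
        by (simp add: rderiv_share[OF assms(1)] min.absorb2 pos_divide_le_eq mult.commute)
      then have "q ^ k * r' (share k x) = r' x"
        using power_q_pos[of k] p by simp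
      then show ?thesis by simp
    qed
    ultimately show ?thesis by (simp add: algebra_simps)
  qed
  then have "(\<Sum>k<n. q ^ k * r (u k)) \<le> (\<Sum>k<n. q ^ k * r (share k x) + r' x * (u k - share k x))"
    by (rule sum_mono)
  then show ?thesis
    by (simp add: sum.distrib sum_subtractf right_diff_distrib sum_distrib_left)
qed

section \<open>The value function and its Bellman equation\<close>

lemma ex_value_function:
  assumes "0 \<le> c"
  obtains V where "\<And>b. 0 \<le> V b" "mono V" "concave_on {0..c} V"
    "\<And>b u. 0 \<le> u \<Longrightarrow> u \<le> b \<Longrightarrow> b \<le> c \<Longrightarrow> r u + q * V (b - u) \<le> V b"
    "\<And>b. b \<in> {0..c} \<Longrightarrow> r (omega r p b) + q * V (b - omega r p b) = V b"
proof -
  let ?\<omega> = "omega r p"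
  obtain n where n: "q ^ Suc n * r' 0 \<le> r' c"
    using ex_horizon[OF assms] by auto
  define m where "m = Suc n"
  \<comment> \<open>One horizon serves all levels up to \<open>c\<close> since \<open>omega\<close>
    does not exceed the level. Both \<open>m\<close> and \<open>Suc m\<close> are needed: the
    recursion prepends one slot to a sum of \<open>m\<close> terms.\<close>
  have horizon: "q ^ m * r' 0 \<le> r' (?\<omega> b)" "q ^ Suc m * r' 0 \<le> r' (?\<omega> b)" if "b \<in> {0..c}" for b
  proof -
    have "?\<omega> b \<le> c" "0 \<le> ?\<omega> b"
      using omega_le[of b] omega_nonneg[of b] that by auto
    then show "q ^ m * r' 0 \<le> r' (?\<omega> b)"
      using n rderiv_antimono[of "?\<omega> b" c] unfolding m_def by linarith
    moreover have "q ^ Suc m * r' 0 \<le> q ^ m * r' 0"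
      using p rderiv_pos[of 0] by (intro mult_right_mono power_decreasing) auto
    ultimately show "q ^ Suc m * r' 0 \<le> r' (?\<omega> b)" by linarith
  qed
  define V where "V b = (\<Sum>k<m. q ^ k * r (share k (?\<omega> b)))" for b
  have V_Suc: "V b = (\<Sum>k<Suc m. q ^ k * r (share k (?\<omega> b)))" if "b \<in> {0..c}" for b
    unfolding V_def using that omega_nonneg[of b] horizon[OF that] reward_0
    by (intro sum_share_cong[of _ _ _ "\<lambda>k u. q ^ k * r u"]) auto
  have sum_m: "(\<Sum>k<m. share k (?\<omega> b)) = b" and sum_Suc_m: "(\<Sum>k<Suc m. share k (?\<omega> b)) = b"
    if "b \<in> {0..c}" for b
    using that omega_nonneg[of b] eta_omega[of b] horizon[OF that]
      eta_eq_sum_share[of "?\<omega> b" m] eta_eq_sum_share[of "?\<omega> b" "Suc m"] by auto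
  \<comment> \<open>The competing sequence is the optimal one for \<open>b'\<close>; the two
    sequences spend exactly \<open>b'\<close> and \<open>b\<close>.\<close>
  have supergradient: "V b' \<le> V b + r' (?\<omega> b) * (b' - b)" if "b \<in> {0..c}" "b' \<in> {0..c}" for b b'
    using weighted_share_optimal[of "?\<omega> b" "\<lambda>k. share k (?\<omega> b')" m] that omega_nonneg share_nonneg
    by (simp add: sum_m V_def)
  have rec: "r (?\<omega> b) + q * V (b - ?\<omega> b) = V b" if b: "b \<in> {0..c}" for b
  proof -
    let ?x = "?\<omega> b"
    have x: "0 \<le> ?x" "?x \<le> b" using b omega_nonneg omega_le by auto
    \<comment> \<open>The shares after the first one are generated by \<open>share 1 ?x\<close> and
      spend the leftover energy exactly, so \<open>share 1 ?x\<close> is the value of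
      \<open>omega\<close> at the leftover level.\<close>
    have "q ^ m * r' 0 \<le> r' (share 1 ?x)"
      using horizon[OF b] rderiv_antimono[of "share 1 ?x" ?x] share_nonneg share_le x
      by (meson order_trans)
    then have "eta r p (share 1 ?x) = (\<Sum>k<m. share (Suc k) ?x)"
      using eta_eq_sum_share[of "share 1 ?x" m] share_nonneg share_share x by simp
    also have "\<dots> = b - ?x"
      using sum_Suc_m[OF b] share_0[OF x(1)] unfolding sum.lessThan_Suc_shift by simp
    finally have "?\<omega> (b - ?x) = share 1 ?x"
      using omega_eqI share_nonneg x by blast
    then have "q * V (b - ?x) = (\<Sum>k<m. q ^ Suc k * r (share (Suc k) ?x))"
      using x by (simp add: V_def share_share sum_distrib_left mult.assoc)
    then show ?thesis
      using V_Suc[OF b] share_0[OF x(1)] unfolding sum.lessThan_Suc_shift by simp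
  qed
  have opt: "r u + q * V (b - u) \<le> V b" if u: "0 \<le> u" "u \<le> b" "b \<le> c" for b u
  proof -
    \<comment> \<open>Spend \<open>u\<close> first and then follow the optimal sequence for
      \<open>b - u\<close>. The total is \<open>b\<close>, which kills the multiplier term.\<close>
    define w where "w = case_nat u (\<lambda>k. share k (?\<omega> (b - u)))"
    have b: "b \<in> {0..c}" "b - u \<in> {0..c}" using u by auto
    have "0 \<le> w k" for k
      using u omega_nonneg share_nonneg by (auto simp: w_def split: nat.split)
    then have "(\<Sum>k<Suc m. q ^ k * r (w k)) \<le> V b + r' (?\<omega> b) * ((\<Sum>k<Suc m. w k) - b)"
      using weighted_share_optimal[of "?\<omega> b" w "Suc m"] omega_nonneg b
      by (simp only: sum_Suc_m V_Suc) auto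
    moreover have "(\<Sum>k<Suc m. w k) = b"
      using sum_m[OF b(2)] by (simp only: sum.lessThan_Suc_shift) (simp add: w_def)
    moreover have "(\<Sum>k<Suc m. q ^ k * r (w k)) = r u + q * V (b - u)"
      by (simp only: sum.lessThan_Suc_shift) (simp add: w_def V_def sum_distrib_left mult.assoc)
    ultimately show ?thesis by simp
  qed
  \<comment> \<open>Levels outside \<open>{0..c}\<close> carry no meaning. Clamping makes the value
    function monotone on all reals, which later gives Borel measurability.\<close>
  define clamp where "clamp b = max 0 (min c b)" for b
  have clamp: "clamp b \<in> {0..c}" "b \<in> {0..c} \<Longrightarrow> clamp b = b" for b
    using assms by (auto simp: clamp_def)
  show thesis
  proof (rule that)
    show "0 \<le> V (clamp b)" for b
      unfolding V_def using clamp(1)[of b] omega_nonneg share_nonneg reward_nonneg power_q_pos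
      by (intro sum_nonneg mult_nonneg_nonneg) (auto simp: less_imp_le)
    show "mono (\<lambda>b. V (clamp b))"
    proof (rule monoI)
      fix x y :: real assume "x \<le> y"
      then have "clamp x \<le> clamp y" by (auto simp: clamp_def)
      then have "r' (?\<omega> (clamp y)) * (clamp x - clamp y) \<le> 0"
        using clamp(1)[of y] rderiv_pos[of "?\<omega> (clamp y)"] omega_nonneg[of "clamp y"]
        by (simp add: mult_nonneg_nonpos)
      then show "V (clamp x) \<le> V (clamp y)"
        using supergradient[OF clamp(1) clamp(1), of x y] by linarith
    qed
    show "concave_on {0..c} (\<lambda>b. V (clamp b))"
      unfolding concave_on_iff
    proof (intro conjI ballI allI impI)
      fix x y u v :: real
      assume *: "x \<in> {0..c}" "y \<in> {0..c}" "0 \<le> u" "0 \<le> v" "u + v = 1"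
      define z where "z = u * x + v * y"
      have z: "z \<in> {0..c}"
        using convexD[OF convex_real_interval(5), of x 0 c y u v] * by (simp add: z_def)
      \<comment> \<open>Averaging the supergradient inequalities at \<open>z\<close> cancels the
        slope terms.\<close>
      have "u * V x + v * V y \<le> u * (V z + r' (?\<omega> z) * (x - z)) + v * (V z + r' (?\<omega> z) * (y - z))"
        using * z by (intro add_mono mult_left_mono supergradient) auto
      also have "\<dots> = (u + v) * V z + r' (?\<omega> z) * (z - (u + v) * z)"
        by (simp add: z_def algebra_simps)
      finally show "u * V (clamp x) + v * V (clamp y) \<le> V (clamp (u *\<^sub>R x + v *\<^sub>R y))"
        using * z by (simp add: z_def clamp)
    qed simp
    show "r u + q * V (clamp (b - u)) \<le> V (clamp b)" if "0 \<le> u" "u \<le> b" "b \<le> c" for b u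
      using opt[OF that] that by (simp add: clamp)
    show "r (?\<omega> b) + q * V (clamp (b - ?\<omega> b)) = V (clamp b)" if "b \<in> {0..c}" for b
      using rec[OF that] that omega_nonneg[of b] omega_le[of b] by (simp add: clamp)
  qed
qed

end

section \<open>Battery levels under i.i.d. arrivals\<close>

lemma restrict_eq_if_eq: "(\<And>i. i \<in> A \<Longrightarrow> x i = y i) \<Longrightarrow> restrict x A = restrict y A"
  by (simp add: restrict_def fun_eq_iff)

lemma consumption_cong:
  "(\<And>i. i \<in> {1..t} \<Longrightarrow> x i = y i) \<Longrightarrow> consumption \<pi> x t = consumption \<pi> y t"
  unfolding consumption_def by (metis restrict_eq_if_eq)

text \<open>Causality is what later permits passing to finitely many arrivals and integrating over
  the newest one separately.\<close>

lemma level_before_cong: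
  "(\<And>i. i \<in> {1..<t} \<Longrightarrow> x i = y i) \<Longrightarrow> level_before c \<pi> x t = level_before c \<pi> y t"
proof (induction t rule: level_before.induct[of _ c \<pi> x])
  case (3 c \<pi> x n)
  then show ?case using consumption_cong[of "Suc n" x y \<pi>] by auto
qed auto

lemma level_after_cong:
  assumes "\<And>i. i \<in> {1..t} \<Longrightarrow> x i = y i" "1 \<le> t"
  shows "level_after c \<pi> x t = level_after c \<pi> y t"
  unfolding level_after_def using assms level_before_cong[of t x y c \<pi>] by auto

lemma level_after_Suc:
  assumes "1 \<le> t"
  shows "level_after c \<pi> x (Suc t) = min (level_after c \<pi> x t - consumption \<pi> x t + x (Suc t)) c"
  using assms by (cases t) (auto simp: level_after_def)

locale admissible_policy =
  fixes c :: real and \<pi> :: policy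
  assumes c_pos: "0 < c" and admissible: "\<pi> \<in> admissible_policies c"
begin

lemma path_bounds:
  assumes "\<And>i. i \<in> {1..t} \<Longrightarrow> 0 \<le> x i" "1 \<le> t"
  shows "level_after c \<pi> x t \<in> {0..c}" "0 \<le> consumption \<pi> x t"
    "consumption \<pi> x t \<le> level_after c \<pi> x t"
proof -
  \<comment> \<open>Admissibility speaks of sequences that are nonnegative in every slot. Later
    arrivals are set to 0, which by causality changes nothing up to \<open>t\<close>.\<close>
  define y where "y i = (if i \<in> {1..t} then x i else 0)" for i
  have y: "0 \<le> y i" for i using assms by (simp add: y_def)
  have cons: "0 \<le> consumption \<pi> y i \<and> consumption \<pi> y i \<le> level_after c \<pi> y i" if "1 \<le> i" for i
    using admissible y that by (simp add: admissible_policies_def)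
  have eq: "level_after c \<pi> x t = level_after c \<pi> y t" "consumption \<pi> x t = consumption \<pi> y t"
    using assms(2) by (auto simp: y_def intro!: level_after_cong consumption_cong)
  show "0 \<le> consumption \<pi> x t" "consumption \<pi> x t \<le> level_after c \<pi> x t"
    using cons[OF assms(2)] eq by auto
  then show "level_after c \<pi> x t \<in> {0..c}"
    by (auto simp: level_after_def)
qed

end

section \<open>Product laws of arrivals on the interval [0,c]\<close>

locale iid_arrivals =
  fixes c :: real and Q :: "real measure"
  assumes prob_Q: "prob_space Q" and sets_Q: "sets Q = sets (restrict_space borel {0..c})"
begin

sublocale Q: prob_space Q by (rule prob_Q)

sublocale product_prob_space "\<lambda>_::nat. Q" "{1..}"
  by (rule product_prob_spaceI) (rule prob_Q)

sublocale iid: prob_space "iid_law Q"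
  unfolding iid_law_def by (rule prob_space_PiM) (rule prob_Q)

lemma space_Q: "space Q = {0..c}"
  using sets_eq_imp_space_eq[OF sets_Q] by (simp add: space_restrict_space)

lemma measurable_ident_Q: "(\<lambda>z. z) \<in> borel_measurable Q"
  by (simp cong: measurable_cong_sets[OF sets_Q refl] add: measurable_restrict_space1)

lemma measurable_ident_nonneg: "(\<lambda>z. z) \<in> Q \<rightarrow>\<^sub>M restrict_space borel {0..}"
  using measurable_ident_Q by (intro measurable_restrict_space2) (auto simp: space_Q)

lemma coordinate_bounds: "x \<in> space (PiM J (\<lambda>_. Q)) \<Longrightarrow> i \<in> J \<Longrightarrow> x i \<in> {0..c}"
  by (auto simp: space_PiM space_Q dest!: PiE_mem)

lemma measurable_coordinate: "i \<in> J \<Longrightarrow> (\<lambda>x. x i) \<in> borel_measurable (PiM J (\<lambda>_. Q))"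
  by (rule measurable_compose[OF measurable_component_singleton[of i J "\<lambda>_. Q"] measurable_ident_Q])

end

lemma arrival_laws_iid_arrivals: "Q \<in> arrival_laws c p \<Longrightarrow> iid_arrivals c Q"
  by (simp add: arrival_laws_def iid_arrivals_def)

locale policy_iid = admissible_policy c \<pi> + iid_arrivals c Q for c \<pi> Q
begin

lemma bounds:
  assumes "x \<in> space (PiM J (\<lambda>_. Q))" "{1..t} \<subseteq> J" "1 \<le> t"
  shows "level_after c \<pi> x t \<in> {0..c}" "0 \<le> consumption \<pi> x t"
    "consumption \<pi> x t \<le> level_after c \<pi> x t"
proof -
  have "0 \<le> x i" if "i \<in> {1..t}" for i
    using coordinate_bounds[OF assms(1), of i] assms(2) that by auto
  from path_bounds[of t x, OF this assms(3)] show "level_after c \<pi> x t \<in> {0..c}" "0 \<le> consumption \<pi> x t"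
    "consumption \<pi> x t \<le> level_after c \<pi> x t"
    by blast+
qed

lemma measurable_consumption:
  assumes "{1..t} \<subseteq> J" "1 \<le> t"
  shows "(\<lambda>x. consumption \<pi> x t) \<in> borel_measurable (PiM J (\<lambda>_. Q))"
proof -
  have "(\<lambda>x. restrict x {1..t}) \<in> PiM J (\<lambda>_. Q) \<rightarrow>\<^sub>M PiM {1..t} (\<lambda>_. restrict_space borel {0..})"
    by (rule measurable_restrict,
        rule measurable_compose[OF measurable_component_singleton[of _ J "\<lambda>_. Q"] measurable_ident_nonneg])
      (use assms(1) in auto)
  moreover have "\<pi> t \<in> PiM {1..t} (\<lambda>_. restrict_space borel {0..}) \<rightarrow>\<^sub>M borel"
    using admissible assms(2) by (simp add: admissible_policies_def)
  ultimately show ?thesis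
    unfolding consumption_def by (rule measurable_compose)
qed

lemma measurable_level_after:
  assumes "{1..t} \<subseteq> J" "1 \<le> t"
  shows "(\<lambda>x. level_after c \<pi> x t) \<in> borel_measurable (PiM J (\<lambda>_. Q))"
  using assms(2,1)
proof (induction t rule: dec_induct)
  case base
  then show ?case using measurable_coordinate[of 1 J] by (simp add: level_after_def)
next
  case (step t)
  then have "{1..t} \<subseteq> J" "Suc t \<in> J" by auto
  with step show ?case
    using measurable_coordinate[of "Suc t" J] measurable_consumption[of t J]
    by (simp add: level_after_Suc)
qed

text \<open>The finite product is the image of the infinite one under restriction to the first
  \<open>t\<close> coordinates.\<close>

lemma integral_finite_horizon:
  fixes f :: "(nat \<Rightarrow> real) \<Rightarrow> real"
  assumes f: "f \<in> borel_measurable (PiM {1..t} (\<lambda>_. Q))"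
    and eq: "\<And>x. f (restrict x {1..t}) = f x"
  shows "(\<integral>x. f x \<partial>iid_law Q) = (\<integral>x. f x \<partial>PiM {1..t} (\<lambda>_. Q))"
proof -
  have "(\<integral>x. f x \<partial>PiM {1..t} (\<lambda>_. Q)) =
      (\<integral>x. f x \<partial>distr (iid_law Q) (PiM {1..t} (\<lambda>_. Q)) (\<lambda>x. restrict x {1..t}))"
    unfolding iid_law_def by (subst distr_PiM_restrict_finite) auto
  also have "\<dots> = (\<integral>x. f (restrict x {1..t}) \<partial>iid_law Q)"
    unfolding iid_law_def using f by (intro integral_distr measurable_restrict_subset) auto
  finally show ?thesis unfolding eq by (rule sym)
qed

lemma measurable_expected_level:
  fixes V :: "real \<Rightarrow> real"
  assumes "{1..t} \<subseteq> J" "1 \<le> t" and V: "mono V"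
  shows "(\<lambda>x. \<integral>z. V (min (level_after c \<pi> x t - consumption \<pi> x t + z) c) \<partial>Q)
    \<in> borel_measurable (PiM J (\<lambda>_. Q))"
proof (rule Q.borel_measurable_lebesgue_integral)
  have V_meas: "V \<in> borel_measurable borel"
    using V by (rule borel_measurable_mono)
  have y: "(\<lambda>x. level_after c \<pi> x t - consumption \<pi> x t) \<in> borel_measurable (PiM J (\<lambda>_. Q))"
    using measurable_level_after measurable_consumption assms by auto
  show "(\<lambda>(x, z). V (min (level_after c \<pi> x t - consumption \<pi> x t + z) c))
      \<in> borel_measurable (PiM J (\<lambda>_. Q) \<Otimes>\<^sub>M Q)"
    unfolding split_beta'
    by (intro measurable_compose[OF _ V_meas] borel_measurable_min borel_measurable_add
        measurable_compose[OF measurable_fst y] measurable_compose[OF measurable_snd measurable_ident_Q]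
        measurable_const) auto
qed

text \<open>The new arrival is independent of the energy left over from the previous slot.\<close>

lemma integral_level_after_Suc:
  fixes V :: "real \<Rightarrow> real"
  assumes "1 \<le> t" and V: "mono V"
  shows "(\<integral>x. V (level_after c \<pi> x (Suc t)) \<partial>iid_law Q) =
    (\<integral>x. (\<integral>z. V (min (level_after c \<pi> x t - consumption \<pi> x t + z) c) \<partial>Q) \<partial>iid_law Q)"
proof -
  let ?P = "\<lambda>t. PiM {1..t} (\<lambda>_. Q)"
  let ?y = "\<lambda>x. level_after c \<pi> x t - consumption \<pi> x t"
  have V_meas: "V \<in> borel_measurable borel"
    using V by (rule borel_measurable_mono)
  interpret PS: prob_space "?P (Suc t)"
    by (rule prob_space_PiM) (rule prob_Q)
  have meas: "(\<lambda>x. V (level_after c \<pi> x (Suc t))) \<in> borel_measurable (?P (Suc t))"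
    using measurable_level_after[of "Suc t" "{1..Suc t}"] by (intro measurable_compose[OF _ V_meas]) simp
  \<comment> \<open>A monotone function on \<open>{0..c}\<close> is bounded by its endpoint values,
    hence integrable along the levels.\<close>
  have bound: "\<bar>V b\<bar> \<le> max \<bar>V 0\<bar> \<bar>V c\<bar>" if "b \<in> {0..c}" for b
    using monoD[OF V, of 0 b] monoD[OF V, of b c] that by auto
  have "integrable (?P (Suc t)) (\<lambda>x. V (level_after c \<pi> x (Suc t)))"
    using bounds(1)[of _ "{1..Suc t}" "Suc t"] bound meas
    by (intro PS.integrable_const_bound[of _ "max \<bar>V 0\<bar> \<bar>V c\<bar>"] AE_I2) auto
  \<comment> \<open>Fubini for finite products splits off the last coordinate; this is why the
    horizon is cut to \<open>{1..Suc t}\<close>.\<close>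
  moreover have insert: "{1..Suc t} = insert (Suc t) {1..t}"
    by auto
  ultimately have "(\<integral>x. V (level_after c \<pi> x (Suc t)) \<partial>?P (Suc t)) =
      (\<integral>x. (\<integral>z. V (level_after c \<pi> (x(Suc t := z)) (Suc t)) \<partial>Q) \<partial>?P t)"
    using product_integral_insert[of "{1..t}" "Suc t"] by simp
  also have "\<dots> = (\<integral>x. (\<integral>z. V (min (?y x + z) c) \<partial>Q) \<partial>?P t)"
  proof -
    have "?y (x(Suc t := z)) = ?y x" for x z
      using assms(1) by (intro arg_cong2[where f = "(-)"] level_after_cong consumption_cong) auto
    then show ?thesis
      using assms(1) by (simp add: level_after_Suc)
  qed
  also have "\<dots> = (\<integral>x. (\<integral>z. V (min (?y x + z) c) \<partial>Q) \<partial>iid_law Q)"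
  proof (rule integral_finite_horizon[symmetric])
    show "(\<lambda>x. \<integral>z. V (min (?y x + z) c) \<partial>Q) \<in> borel_measurable (?P t)"
      using assms by (intro measurable_expected_level) auto
    have "?y (restrict x {1..t}) = ?y x" for x
      using assms(1) by (intro arg_cong2[where f = "(-)"] level_after_cong consumption_cong) auto
    then show "(\<integral>z. V (min (?y (restrict x {1..t}) + z) c) \<partial>Q) = (\<integral>z. V (min (?y x + z) c) \<partial>Q)" for x
      by simp
  qed
  finally have "(\<integral>x. V (level_after c \<pi> x (Suc t)) \<partial>?P (Suc t)) =
      (\<integral>x. (\<integral>z. V (min (?y x + z) c) \<partial>Q) \<partial>iid_law Q)" .
  moreover have "V (level_after c \<pi> (restrict x {1..Suc t}) (Suc t)) = V (level_after c \<pi> x (Suc t))" for x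
    by (intro arg_cong[of _ _ V] level_after_cong) auto
  ultimately show ?thesis
    using integral_finite_horizon[OF meas] by simp
qed

end

section \<open>Least favorable arrivals and the maximin value\<close>

lemma stationary_policy_admissible:
  assumes "0 < c" and rule: "\<And>b. b \<in> {0..c} \<Longrightarrow> 0 \<le> \<sigma> b \<and> \<sigma> b \<le> b" and mono: "mono_on {0..c} \<sigma>"
  shows "stationary_policy c \<sigma> \<in> admissible_policies c"
proof -
  \<comment> \<open>The rule is monotone only on \<open>{0..c}\<close>. Its clamped version is
    monotone everywhere, hence Borel, and yields the same actions along nonnegative
    arrivals.\<close>
  define \<rho> where "\<rho> b = \<sigma> (max 0 (min c b))" for b
  have "mono \<rho>"
    unfolding \<rho>_def using \<open>0 < c\<close> by (intro monoI mono_onD[OF mono]) auto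
  then have \<rho>_meas: "\<rho> \<in> borel_measurable borel"
    by (rule borel_measurable_mono)
  have \<rho>: "\<rho> b = \<sigma> b" if "b \<in> {0..c}" for b
    using that by (simp add: \<rho>_def)
  have level: "stationary_level c \<sigma> x n \<in> {0..c} \<and> stationary_level c \<rho> x n = stationary_level c \<sigma> x n"
    if "\<And>i. i \<in> {1..n} \<Longrightarrow> 0 \<le> x i" "1 \<le> n" for x n
    using that(2,1)
  proof (induction n rule: dec_induct)
    case base
    then show ?case using \<open>0 < c\<close> by simp
  next
    case (step n)
    then obtain m where m: "n = Suc m" by (cases n) auto
    have IH: "stationary_level c \<sigma> x n \<in> {0..c}" "stationary_level c \<rho> x n = stationary_level c \<sigma> x n"
      using step by auto
    have "0 \<le> x (Suc n)"
      using step.prems[of "Suc n"] by simp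
    with IH rule[OF IH(1)] show ?case
      using \<open>0 < c\<close> by (auto simp: m \<rho>)
  qed
  have coord: "(\<lambda>x. x i :: real) \<in> borel_measurable (PiM {1..t} (\<lambda>_. restrict_space borel {0..}))"
    if "i \<in> {1..t}" for i t
    using measurable_compose[OF measurable_component_singleton[OF that, of "\<lambda>_. restrict_space borel {0..}"]
      measurable_restrict_space1[OF measurable_ident]] by simp
  have \<rho>_level_meas: "(\<lambda>x. stationary_level c \<rho> x n) \<in> borel_measurable (PiM {1..t} (\<lambda>_. restrict_space borel {0..}))"
    if "1 \<le> n" "n \<le> t" for n t
    using that
  proof (induction n rule: dec_induct)
    case base
    then show ?case
      using coord[of 1 t] by simp
  next
    case (step n)
    then obtain m where m: "n = Suc m" by (cases n) auto
    have "(\<lambda>x. x (Suc n) :: real) \<in> borel_measurable (PiM {1..t} (\<lambda>_. restrict_space borel {0..}))"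
      using step by (intro coord) auto
    moreover have "(\<lambda>x. stationary_level c \<rho> x n) \<in> borel_measurable (PiM {1..t} (\<lambda>_. restrict_space borel {0..}))"
      using step by simp
    ultimately show ?case
      using measurable_compose[OF _ \<rho>_meas] unfolding m stationary_level.simps
      by (intro borel_measurable_min borel_measurable_add borel_measurable_diff) auto
  qed
  have "stationary_policy c \<sigma> t \<in> borel_measurable (PiM {1..t} (\<lambda>_. restrict_space borel {0..}))"
    if "1 \<le> t" for t
  proof -
    have "(\<lambda>x. \<rho> (stationary_level c \<rho> x t)) \<in> borel_measurable (PiM {1..t} (\<lambda>_. restrict_space borel {0..}))"
      using \<rho>_level_meas[OF that] by (intro measurable_compose[OF _ \<rho>_meas]) simp
    moreover have "\<rho> (stationary_level c \<rho> x t) = stationary_policy c \<sigma> t x"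
      if "x \<in> space (PiM {1..t} (\<lambda>_. restrict_space borel {0..}))" for x
    proof -
      have "0 \<le> x i" if "i \<in> {1..t}" for i
        using \<open>x \<in> space _\<close> that by (auto simp: space_PiM space_restrict_space dest!: PiE_mem)
      then show ?thesis
        using level[of t x] \<open>1 \<le> t\<close> \<rho> by (simp add: stationary_policy_def)
    qed
    ultimately show ?thesis
      by (rule measurable_cong[THEN iffD1, rotated])
  qed
  moreover have "level_after c (stationary_policy c \<sigma>) x t \<in> {0..c}"
    if "\<forall>t\<ge>1. 0 \<le> x t" "1 \<le> t" for x t
    using that(2)
  proof (induction t rule: dec_induct)
    case base
    then show ?case using that \<open>0 < c\<close> by (simp add: level_after_def)
  next
    case (step t)
    have "0 \<le> x (Suc t)" using that by simp
    then show ?case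
      using step rule[OF step.IH] \<open>0 < c\<close>
      by (simp add: level_after_Suc consumption_stationary_policy)
  qed
  ultimately show ?thesis
    unfolding admissible_policies_def using rule by (simp add: consumption_stationary_policy)
qed

lemma
  assumes "0 < c" "0 < p" "p < 1"
  shows scaled_bernoulli_in_arrival_laws: "scaled_bernoulli c p \<in> arrival_laws c p"
    and integral_scaled_bernoulli: "f \<in> borel_measurable (scaled_bernoulli c p) \<Longrightarrow>
      (\<integral>z. f z \<partial>scaled_bernoulli c p) = (1 - p) * f 0 + p * (f c :: real)"
proof -
  let ?B = "scaled_bernoulli c p" and ?S = "restrict_space borel {0..c}"
  have sets_B: "sets ?B = sets ?S"
    unfolding scaled_bernoulli_def Let_def
    by (simp only: sets_measure_of[OF sets.space_closed] sets.sigma_sets_eq)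
  have space_B: "space ?B = {0..c}"
    using sets_eq_imp_space_eq[OF sets_B] by (simp add: space_restrict_space)
  have singleton: "{a} \<in> sets ?S" if "a \<in> {0..c}" for a
    using that by (auto simp: sets_restrict_space image_iff intro!: bexI[of _ "{a}"])
  have "{0..c} \<in> sets ?S"
    by (auto simp: sets_restrict_space image_iff intro!: bexI[of _ "{0..c}"])
  then have "emeasure ?B (space ?B) = 1"
    using assms by (simp add: space_B emeasure_scaled_bernoulli flip: ennreal_plus)
  then have prob: "prob_space ?B" by (rule prob_spaceI)
  then interpret prob_space ?B .
  have integral: "(\<integral>z. f z \<partial>?B) = (1 - p) * f 0 + p * f c"
    if f: "f \<in> borel_measurable ?B" for f :: "real \<Rightarrow> real"
  proof -
    have m: "{0} \<in> sets ?B" "{c} \<in> sets ?B" "{0, c} \<in> sets ?B"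
      using singleton[of 0] singleton[of c] sets.Un[of "{0}" ?S "{c}"] assms
      by (auto simp: sets_B insert_commute)
    \<comment> \<open>The two atoms carry all the mass, so almost everywhere \<open>f\<close> equals
      a combination of two indicators.\<close>
    have "emeasure ?B {0, c} = 1"
      using m assms by (simp add: sets_B emeasure_scaled_bernoulli flip: ennreal_plus)
    then have "AE z in ?B. z \<in> {0, c}"
      unfolding AE_in_set_eq_1[OF m(3)] by (simp add: measure_def)
    then have "(\<integral>z. f z \<partial>?B) = (\<integral>z. indicator {0} z * f 0 + indicator {c} z * f c \<partial>?B)"
      using m f assms by (intro integral_cong_AE) (auto elim!: eventually_mono)
    also have "\<dots> = measure ?B {0} * f 0 + measure ?B {c} * f c"
      using integrable_real_indicator[OF m(1)] integrable_real_indicator[OF m(2)] assms(1)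
      by (subst Bochner_Integration.integral_add)
        (auto simp: space_B emeasure_eq_measure Int_absorb2 intro: integrable_mult_left)
    also have "\<dots> = (1 - p) * f 0 + p * f c"
      using m assms by (simp add: sets_B emeasure_scaled_bernoulli measure_def)
    finally show ?thesis .
  qed
  then show "f \<in> borel_measurable ?B \<Longrightarrow> (\<integral>z. f z \<partial>?B) = (1 - p) * f 0 + p * f c" .
  have "(\<lambda>z. z) \<in> borel_measurable ?B"
    by (simp cong: measurable_cong_sets[OF sets_B refl] add: measurable_restrict_space1)
  then have "(\<integral>z. z \<partial>?B) = p * c"
    using integral by simp
  then show "?B \<in> arrival_laws c p"
    using prob sets_B assms by (simp add: arrival_laws_def)
qed

text \<open>Isolates what the optimality argument needs from the reward: a concave solution of the
  Bellman equation and a monotone maximizer. It is instantiated with \<open>omega\<close> and with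
  its logarithmic closed form.\<close>

locale bellman =
  fixes c p :: real and r V \<sigma> :: "real \<Rightarrow> real"
  assumes c: "0 < c" and p: "0 < p" "p < 1"
    and r_nonneg: "\<And>x. 0 \<le> x \<Longrightarrow> 0 \<le> r x" and r_mono: "mono_on {0..} r"
    and V_nonneg: "\<And>b. 0 \<le> V b" and V_mono: "mono V" and V_concave: "concave_on {0..c} V"
    and bellman_le: "\<And>b u. 0 \<le> u \<Longrightarrow> u \<le> b \<Longrightarrow> b \<le> c \<Longrightarrow> r u + (1 - p) * V (b - u) \<le> V b"
    and bellman_eq: "\<And>b. b \<in> {0..c} \<Longrightarrow> r (\<sigma> b) + (1 - p) * V (b - \<sigma> b) = V b"
    and rule: "\<And>b. b \<in> {0..c} \<Longrightarrow> 0 \<le> \<sigma> b \<and> \<sigma> b \<le> b" and rule_mono: "mono_on {0..c} \<sigma>"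
begin

text \<open>Concavity compares an arrival \<open>z\<close> with the arrival that is \<open>c\<close> with probability \<open>z / c\<close> and
  \<open>0\<close> otherwise; this is why the Bernoulli law is least favorable.\<close>

lemma V_chord:
  assumes "y \<in> {0..c}" "z \<in> {0..c}"
  shows "(1 - z / c) * V y + z / c * V c \<le> V (min (y + z) c)"
proof -
  have z: "0 \<le> z / c" "z / c \<le> 1" using assms c by auto
  have "(1 - z / c) * V y + z / c * V c \<le> V ((1 - z / c) * y + z / c * c)"
    using V_concave[unfolded concave_on_iff, THEN conjunct2, rule_format, of y c "1 - z / c" "z / c"]
      z assms c by simp
  also have "\<dots> \<le> V (min (y + z) c)"
  proof (rule monoD[OF V_mono])
    \<comment> \<open>Bounding the weighted \<open>y\<close> by \<open>y\<close> gives the bound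
      \<open>y + z\<close>; replacing \<open>y\<close> by \<open>c\<close> gives the bound
      \<open>c\<close>.\<close>
    have "(1 - z / c) * y \<le> 1 * y" "(1 - z / c) * y \<le> (1 - z / c) * c"
      using z assms by (intro mult_right_mono mult_left_mono; simp)+
    then show "(1 - z / c) * y + z / c * c \<le> min (y + z) c"
      using c by (simp add: algebra_simps)
  qed
  finally show ?thesis .
qed

text \<open>The chord bound is affine in \<open>z\<close>, so its expectation depends on
  \<open>Q\<close> only through the mean \<open>p * c\<close>.\<close>

lemma expected_V_ge:
  assumes Q: "Q \<in> arrival_laws c p" and y: "y \<in> {0..c}"
  shows "(1 - p) * V y + p * V c \<le> (\<integral>z. V (min (y + z) c) \<partial>Q)"
proof -
  interpret iid_arrivals c Q
    using Q by (rule arrival_laws_iid_arrivals)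
  have int_id: "integrable Q (\<lambda>z. z)"
    using measurable_ident_Q by (intro Q.integrable_const_bound[of _ c] AE_I2) (auto simp: space_Q)
  have mean: "(\<integral>z. z \<partial>Q) = p * c"
    using Q c by (simp add: arrival_laws_def field_simps)
  have "integrable Q (\<lambda>z. V (min (y + z) c))"
    using measurable_ident_Q V_nonneg
    by (intro Q.integrable_const_bound[of _ "V c"] AE_I2 measurable_compose[OF _ borel_measurable_mono[OF V_mono]])
      (auto intro: monoD[OF V_mono])
  moreover have eq: "(1 - z / c) * V y + z / c * V c = V y + z * ((V c - V y) / c)" for z
    using c by (simp add: field_simps)
  ultimately have "(\<integral>z. V y + z * ((V c - V y) / c) \<partial>Q) \<le> (\<integral>z. V (min (y + z) c) \<partial>Q)"
    using int_id V_chord[OF y] by (intro integral_mono) (auto simp: space_Q simp flip: eq)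
  also have "(\<integral>z. V y + z * ((V c - V y) / c) \<partial>Q) = V y + p * c * ((V c - V y) / c)"
    using int_id mean by (simp add: Q.prob_space)
  also have "\<dots> = (1 - p) * V y + p * V c"
    using c by (simp add: field_simps)
  finally show ?thesis .
qed

text \<open>Equality case: an arrival \<open>c\<close> fills the battery from any level, and an
  arrival 0 leaves \<open>y\<close>.\<close>

lemma expected_V_bernoulli:
  assumes y: "y \<in> {0..c}"
  shows "(\<integral>z. V (min (y + z) c) \<partial>scaled_bernoulli c p) = (1 - p) * V y + p * V c"
proof -
  interpret iid_arrivals c "scaled_bernoulli c p"
    using scaled_bernoulli_in_arrival_laws[OF c p] by (rule arrival_laws_iid_arrivals)
  have "(\<lambda>z. V (min (y + z) c)) \<in> borel_measurable (scaled_bernoulli c p)"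
    using measurable_ident_Q by (intro measurable_compose[OF _ borel_measurable_mono[OF V_mono]]) auto
  then show ?thesis
    using integral_scaled_bernoulli[OF c p] y by simp
qed

lemma stationary_admissible: "stationary_policy c \<sigma> \<in> admissible_policies c"
  using c rule rule_mono by (rule stationary_policy_admissible)

end

section \<open>Average rewards by telescoping\<close>

locale bellman_policy = bellman c p r V \<sigma> + policy_iid c \<pi> Q for c p r V \<sigma> \<pi> Q
begin

definition expected_reward :: "nat \<Rightarrow> real" where
  "expected_reward t = (\<integral>x. r (consumption \<pi> x t) \<partial>iid_law Q)"

definition expected_value :: "nat \<Rightarrow> real" where
  "expected_value t = (\<integral>x. V (level_after c \<pi> x t) \<partial>iid_law Q)"

lemma bounds_iid:
  assumes "x \<in> space (iid_law Q)" "1 \<le> t"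
  shows "level_after c \<pi> x t \<in> {0..c}" "0 \<le> consumption \<pi> x t"
    "consumption \<pi> x t \<le> level_after c \<pi> x t"
  using bounds[of x "{1..}" t] assms by (auto simp: iid_law_def)

lemma integrable_reward:
  assumes "1 \<le> t"
  shows "integrable (iid_law Q) (\<lambda>x. r (consumption \<pi> x t))"
proof (rule iid.integrable_const_bound[of _ "r c"])
  show "AE x in iid_law Q. norm (r (consumption \<pi> x t)) \<le> r c"
  proof (rule AE_I2)
    fix x assume "x \<in> space (iid_law Q)"
    then show "norm (r (consumption \<pi> x t)) \<le> r c"
      using bounds_iid[of x t] assms r_nonneg mono_onD[OF r_mono, of "consumption \<pi> x t" c] by auto
  qed
  \<comment> \<open>\<open>r\<close> is monotone only on the half-line; consumption is nonnegative
    there almost surely, so truncation at 0 gives measurability without changing the reward.\<close>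
  have "mono (\<lambda>u. r (max 0 u))"
    by (intro monoI mono_onD[OF r_mono]) auto
  then have "(\<lambda>x. r (max 0 (consumption \<pi> x t))) \<in> borel_measurable (iid_law Q)"
    using measurable_consumption[of t "{1..}"] assms unfolding iid_law_def
    by (intro measurable_compose[OF _ borel_measurable_mono[of "\<lambda>u. r (max 0 u)"]]) simp_all
  then show "(\<lambda>x. r (consumption \<pi> x t)) \<in> borel_measurable (iid_law Q)"
    by (rule measurable_cong[THEN iffD1, rotated]) (simp add: bounds_iid(2)[OF _ assms] max_absorb2)
qed

lemma integrable_value:
  assumes "1 \<le> t"
  shows "integrable (iid_law Q) (\<lambda>x. V (level_after c \<pi> x t))"
proof (rule iid.integrable_const_bound[of _ "V c"])
  show "AE x in iid_law Q. norm (V (level_after c \<pi> x t)) \<le> V c"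
    using bounds_iid(1) assms V_nonneg by (intro AE_I2) (auto intro!: monoD[OF V_mono])
  show "(\<lambda>x. V (level_after c \<pi> x t)) \<in> borel_measurable (iid_law Q)"
    using measurable_level_after[of t "{1..}"] assms unfolding iid_law_def
    by (intro measurable_compose[OF _ borel_measurable_mono[OF V_mono]]) auto
qed

lemma expected_value_bounds:
  assumes "1 \<le> t"
  shows "0 \<le> expected_value t" "expected_value t \<le> V c"
proof -
  show "0 \<le> expected_value t"
    unfolding expected_value_def using V_nonneg by simp
  show "expected_value t \<le> V c"
    unfolding expected_value_def using integrable_value[OF assms] bounds_iid(1) assms
    by (intro iid.integral_le_const AE_I2) (auto intro!: monoD[OF V_mono])
qed

lemma average_reward_eq:
  "average_reward r \<pi> (iid_law Q) = liminf (\<lambda>n. ereal ((\<Sum>t=1..n. expected_reward t) / real n))"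
  unfolding average_reward_def expected_reward_def
  using integrable_reward by (subst Bochner_Integration.integral_sum[symmetric]) auto

text \<open>The expected values telescope and stay between 0 and \<open>V c\<close>, so the
  remainder is at most \<open>V c / n\<close> after averaging.\<close>

lemma average_reward_le:
  assumes "\<And>t. 1 \<le> t \<Longrightarrow> expected_reward t \<le> v + expected_value t - expected_value (Suc t)"
  shows "average_reward r \<pi> (iid_law Q) \<le> ereal v"
proof -
  have "(\<Sum>t=1..n. expected_reward t) \<le> real n * v + expected_value 1 - expected_value (Suc n)" for n
  proof (induction n)
    case (Suc n)
    then show ?case using assms[of "Suc n"] by (simp add: algebra_simps)
  qed simp
  then have sum_le: "(\<Sum>t=1..n. expected_reward t) \<le> real n * v + V c" for n
    using expected_value_bounds[of 1] expected_value_bounds[of "Suc n"] by (smt (verit) le_add1 plus_1_eq_Suc order_refl)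
  have "(\<Sum>t=1..n. expected_reward t) / real n \<le> v + V c / real n" if "1 \<le> n" for n
    using sum_le[of n] that by (simp add: field_simps)
  then have "average_reward r \<pi> (iid_law Q) \<le> liminf (\<lambda>n. ereal (v + V c / real n))"
    unfolding average_reward_eq
    by (intro Liminf_mono eventually_sequentiallyI[of 1]) simp
  also have "(\<lambda>n. v + V c / real n) \<longlonglongrightarrow> v + 0"
    by (intro tendsto_intros lim_const_over_n)
  then have "liminf (\<lambda>n. ereal (v + V c / real n)) = ereal v"
    by (intro lim_imp_Liminf) (simp_all add: lim_ereal)
  finally show ?thesis .
qed

lemma average_reward_ge:
  assumes "\<And>t. 1 \<le> t \<Longrightarrow> v + expected_value t - expected_value (Suc t) \<le> expected_reward t"
  shows "ereal v \<le> average_reward r \<pi> (iid_law Q)"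
proof -
  have "real n * v + expected_value 1 - expected_value (Suc n) \<le> (\<Sum>t=1..n. expected_reward t)" for n
  proof (induction n)
    case (Suc n)
    then show ?case using assms[of "Suc n"] by (simp add: algebra_simps)
  qed simp
  then have sum_ge: "real n * v - V c \<le> (\<Sum>t=1..n. expected_reward t)" for n
    using expected_value_bounds[of 1] expected_value_bounds[of "Suc n"] by (smt (verit) le_add1 plus_1_eq_Suc order_refl)
  have "v - V c / real n \<le> (\<Sum>t=1..n. expected_reward t) / real n" if "1 \<le> n" for n
  proof -
    have "v - V c / real n = (real n * v - V c) / real n"
      using that by (simp add: field_simps)
    then show ?thesis using sum_ge[of n] by (simp add: divide_right_mono)
  qed
  then have "liminf (\<lambda>n. ereal (v - V c / real n)) \<le> average_reward r \<pi> (iid_law Q)"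
    unfolding average_reward_eq
    by (intro Liminf_mono eventually_sequentiallyI[of 1]) simp
  moreover have "(\<lambda>n. v - V c / real n) \<longlonglongrightarrow> v - 0"
    by (intro tendsto_intros lim_const_over_n)
  then have "liminf (\<lambda>n. ereal (v - V c / real n)) = ereal v"
    by (intro lim_imp_Liminf) (simp_all add: lim_ereal)
  ultimately show ?thesis by simp
qed

lemma expected_value_Suc:
  assumes "1 \<le> t"
  shows "expected_value (Suc t) =
    (\<integral>x. (\<integral>z. V (min (level_after c \<pi> x t - consumption \<pi> x t + z) c) \<partial>Q) \<partial>iid_law Q)"
  unfolding expected_value_def by (rule integral_level_after_Suc[OF assms V_mono])

lemma integral_value_minus_reward:
  assumes "1 \<le> t"
  shows "(\<integral>x. V (level_after c \<pi> x t) - r (consumption \<pi> x t) + v \<partial>iid_law Q) =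
    expected_value t - expected_reward t + v"
  unfolding expected_value_def expected_reward_def
  using integrable_value[OF assms] integrable_reward[OF assms] by (simp add: iid.prob_space)

end

section \<open>The two inequalities of the saddle point\<close>

context bellman
begin

text \<open>Against the Bernoulli law the expected next value is known exactly, so the only
  inequality is the Bellman one, valid for any feasible action.\<close>

lemma average_reward_bernoulli_le:
  assumes "\<pi> \<in> admissible_policies c"
  shows "average_reward r \<pi> (iid_law (scaled_bernoulli c p)) \<le> ereal (p * V c)"
proof -
  let ?B = "scaled_bernoulli c p"
  interpret bellman_policy c p r V \<sigma> \<pi> ?B
    using scaled_bernoulli_in_arrival_laws[OF c p] assms c bellman_axioms
    by (intro bellman_policy.intro policy_iid.intro admissible_policy.intro arrival_laws_iid_arrivals)
  show ?thesis
  proof (rule average_reward_le)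
    fix t :: nat assume t: "1 \<le> t"
    have *: "(1 - p) * V (level_after c \<pi> x t - consumption \<pi> x t) + p * V c \<le>
        V (level_after c \<pi> x t) - r (consumption \<pi> x t) + p * V c"
      if "x \<in> space (iid_law ?B)" for x
      using bellman_le bounds_iid[OF that t] by (simp add: algebra_simps)
    have "expected_value (Suc t) \<le>
        (\<integral>x. V (level_after c \<pi> x t) - r (consumption \<pi> x t) + p * V c \<partial>iid_law ?B)"
      unfolding expected_value_Suc[OF t]
    \<comment> \<open>This rule asks for integrability of the larger side only, at the price of its
      nonnegativity.\<close>
    proof (rule integral_mono')
      show "integrable (iid_law ?B) (\<lambda>x. V (level_after c \<pi> x t) - r (consumption \<pi> x t) + p * V c)"
        using integrable_value[OF t] integrable_reward[OF t] by auto
      fix x assume x: "x \<in> space (iid_law ?B)"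
      have "0 \<le> (1 - p) * V (level_after c \<pi> x t - consumption \<pi> x t) + p * V c"
        using p V_nonneg by simp
      then show "0 \<le> V (level_after c \<pi> x t) - r (consumption \<pi> x t) + p * V c"
        using *[OF x] by linarith
      show "(\<integral>z. V (min (level_after c \<pi> x t - consumption \<pi> x t + z) c) \<partial>?B) \<le>
          V (level_after c \<pi> x t) - r (consumption \<pi> x t) + p * V c"
        using *[OF x] bounds_iid[OF x t] by (subst expected_V_bernoulli) auto
    qed
    then show "expected_reward t \<le> p * V c + expected_value t - expected_value (Suc t)"
      using integral_value_minus_reward[OF t] by simp
  qed
qed

text \<open>Roles are exchanged: the Bellman relation is an equality along the rule, and concavity
  of \<open>V\<close> supplies the inequality for an arbitrary law.\<close>

lemma average_reward_rule_ge:
  assumes Q: "Q \<in> arrival_laws c p"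
  shows "ereal (p * V c) \<le> average_reward r (stationary_policy c \<sigma>) (iid_law Q)"
proof -
  let ?\<pi> = "stationary_policy c \<sigma>"
  interpret bellman_policy c p r V \<sigma> ?\<pi> Q
    using Q stationary_admissible c bellman_axioms
    by (intro bellman_policy.intro policy_iid.intro admissible_policy.intro arrival_laws_iid_arrivals)
  show ?thesis
  proof (rule average_reward_ge)
    fix t :: nat assume t: "1 \<le> t"
    have "(\<integral>x. V (level_after c ?\<pi> x t) - r (consumption ?\<pi> x t) + p * V c \<partial>iid_law Q) \<le>
        expected_value (Suc t)"
      unfolding expected_value_Suc[OF t]
    proof (rule integral_mono)
      show "integrable (iid_law Q) (\<lambda>x. V (level_after c ?\<pi> x t) - r (consumption ?\<pi> x t) + p * V c)"
        using integrable_value[OF t] integrable_reward[OF t] by auto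
      let ?W = "\<lambda>x. \<integral>z. V (min (level_after c ?\<pi> x t - consumption ?\<pi> x t + z) c) \<partial>Q"
      have "integrable Q (\<lambda>z. V (min (y + z) c))" for y
        using measurable_ident_Q V_nonneg
        by (intro Q.integrable_const_bound[of _ "V c"] AE_I2 measurable_compose[OF _ borel_measurable_mono[OF V_mono]])
          (auto intro: monoD[OF V_mono])
      then have "?W x \<le> V c" for x
        by (intro Q.integral_le_const AE_I2) (auto intro: monoD[OF V_mono])
      moreover have "0 \<le> ?W x" for x
        using V_nonneg by simp
      ultimately show "integrable (iid_law Q) ?W"
        using measurable_expected_level[of t "{1..}", OF _ t V_mono]
        by (intro iid.integrable_const_bound[of _ "V c"] AE_I2) (auto simp: iid_law_def)
      fix x assume x: "x \<in> space (iid_law Q)"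
      have "V (level_after c ?\<pi> x t) - r (consumption ?\<pi> x t) + p * V c =
          (1 - p) * V (level_after c ?\<pi> x t - consumption ?\<pi> x t) + p * V c"
        using bellman_eq[OF bounds_iid(1)[OF x t]] t by (simp add: consumption_stationary_policy)
      also have "\<dots> \<le> ?W x"
        using bounds_iid[OF x t] by (intro expected_V_ge[OF Q]) auto
      finally show "V (level_after c ?\<pi> x t) - r (consumption ?\<pi> x t) + p * V c \<le> ?W x" .
    qed
    then show "p * V c + expected_value t - expected_value (Suc t) \<le> expected_reward t"
      using integral_value_minus_reward[OF t] by simp
  qed
qed

lemma average_reward_rule_bernoulli:
  "average_reward r (stationary_policy c \<sigma>) (iid_law (scaled_bernoulli c p)) = ereal (p * V c)"
  using average_reward_bernoulli_le[OF stationary_admissible]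
    average_reward_rule_ge[OF scaled_bernoulli_in_arrival_laws[OF c p]]
  by (rule antisym)

lemma worst_case_reward_rule:
  "worst_case_reward r c p (stationary_policy c \<sigma>) = ereal (p * V c)"
  unfolding worst_case_reward_def
proof (rule antisym)
  show "(INF Q\<in>arrival_laws c p. average_reward r (stationary_policy c \<sigma>) (iid_law Q)) \<le> ereal (p * V c)"
    using scaled_bernoulli_in_arrival_laws[OF c p] average_reward_rule_bernoulli
    by (intro INF_lower2) auto
qed (intro INF_greatest average_reward_rule_ge)

text \<open>The rule and the Bernoulli law form a saddle point with value
  \<open>p * V c\<close>.\<close>

lemma maximin_optimal_rule: "maximin_optimal r c p (stationary_policy c \<sigma>)"
  unfolding maximin_optimal_def
proof (intro conjI antisym)
  have "worst_case_reward r c p \<pi> \<le> ereal (p * V c)" if "\<pi> \<in> admissible_policies c" for \<pi>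
    unfolding worst_case_reward_def
    using scaled_bernoulli_in_arrival_laws[OF c p] average_reward_bernoulli_le[OF that]
    by (rule INF_lower2)
  then show "(SUP \<pi>\<in>admissible_policies c. worst_case_reward r c p \<pi>) \<le>
      worst_case_reward r c p (stationary_policy c \<sigma>)"
    unfolding worst_case_reward_rule by (rule SUP_least)
  show "worst_case_reward r c p (stationary_policy c \<sigma>) \<le>
      (SUP \<pi>\<in>admissible_policies c. worst_case_reward r c p \<pi>)"
    using stationary_admissible by (rule SUP_upper)
qed (rule stationary_admissible)

end

lemma (in discounted_reward) is_stationary_rule_omega: "is_stationary_rule c (omega r p)"
  unfolding is_stationary_rule_def using omega_nonneg omega_le by (meson atLeastAtMost_iff order_trans)

text \<open>Agreement with \<open>omega\<close> is asked on \<open>{0..c}\<close> only, so that a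
  closed formula can take its place.\<close>

lemma (in discounted_reward) ex_bellman:
  assumes "0 < c" and \<sigma>: "\<And>b. b \<in> {0..c} \<Longrightarrow> \<sigma> b = omega r p b"
  obtains V where "bellman c p r V \<sigma>"
proof -
  obtain V where V: "\<And>b. 0 \<le> V b" "mono V" "concave_on {0..c} V"
    "\<And>b u. 0 \<le> u \<Longrightarrow> u \<le> b \<Longrightarrow> b \<le> c \<Longrightarrow> r u + q * V (b - u) \<le> V b"
    "\<And>b. b \<in> {0..c} \<Longrightarrow> r (omega r p b) + q * V (b - omega r p b) = V b"
    using ex_value_function[of c] assms(1) by auto
  have "bellman c p r V \<sigma>"
  proof
    show "mono_on {0..c} \<sigma>"
      using omega_mono by (intro mono_onI) (simp add: \<sigma>)
    show "0 \<le> \<sigma> b \<and> \<sigma> b \<le> b" if "b \<in> {0..c}" for b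
      using that omega_nonneg omega_le by (simp add: \<sigma>)
    show "r (\<sigma> b) + q * V (b - \<sigma> b) = V b" if "b \<in> {0..c}" for b
      using that V(5) by (simp add: \<sigma>)
  qed (use V(1-4) p reward_nonneg reward_mono assms(1) in auto)
  then show thesis by (rule that)
qed

section \<open>The logarithmic reward\<close>

lemma ln_less_tangent:
  fixes x z :: real
  assumes "0 < x" "0 < z" "x \<noteq> z"
  shows "ln x < ln z + (x - z) / z"
proof -
  have "ln (x / z) < x / z - 1"
    using ln_le_minus_one[of "x / z"] ln_eq_minus_one[of "x / z"] assms by fastforce
  then show ?thesis
    using assms by (simp add: ln_div diff_divide_distrib)
qed

section \<open>The logarithm as a strictly concave reward\<close>

context
  fixes \<gamma> :: real
  assumes \<gamma>: "0 < \<gamma>"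
begin

definition awgn :: "real \<Rightarrow> real" where
  "awgn u = 1 / 2 * ln (1 + \<gamma> * u)"

lemma one_plus_pos: "0 \<le> u \<Longrightarrow> 0 < 1 + \<gamma> * u"
  using \<gamma> by (simp add: add_pos_nonneg)

lemma awgn_has_derivative:
  assumes "0 \<le> x"
  shows "(awgn has_real_derivative \<gamma> / (2 * (1 + \<gamma> * x))) (at x within S)"
  unfolding awgn_def[abs_def] using one_plus_pos[OF assms]
  by (auto intro!: derivative_eq_intros simp: field_simps)

lemma rderiv_awgn:
  assumes "0 \<le> x"
  shows "rderiv awgn x = \<gamma> / (2 * (1 + \<gamma> * x))"
  unfolding rderiv_def
proof (rule vector_derivative_within)
  have "x islimpt {x<..<x+1}"
    by (rule islimpt_greaterThanLessThan1) simp
  then have "x islimpt {0..}"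
    by (rule islimpt_subset) (use assms in auto)
  then show "at x within {0..} \<noteq> bot"
    by (simp add: trivial_limit_within)
  show "(awgn has_vector_derivative \<gamma> / (2 * (1 + \<gamma> * x))) (at x within {0..})"
    using awgn_has_derivative[OF assms] by (simp add: has_real_derivative_iff_has_vector_derivative)
qed

text \<open>The strict tangent inequalities at the mixture \<open>z\<close> are averaged, and the
  slope terms cancel.\<close>

lemma strictly_concave_awgn: "strictly_concave_on {0..} awgn"
  unfolding strictly_concave_on_def
proof (intro conjI ballI allI impI)
  fix x y u v :: real
  assume *: "x \<in> {0..}" "y \<in> {0..}" "x \<noteq> y" "0 < u" "0 < v" "u + v = 1"
  let ?f = "\<lambda>x. 1 + \<gamma> * x"
  define z where "z = u * x + v * y"
  have "0 \<le> z" using * by (simp add: z_def)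
  have v: "v = 1 - u" using * by simp
  have "z \<noteq> x" "z \<noteq> y"
  proof -
    have "z - x = v * (y - x)" "z - y = u * (x - y)"
      by (simp_all add: z_def v algebra_simps)
    then show "z \<noteq> x" "z \<noteq> y" using * by auto
  qed
  then have "u * ln (?f x) + v * ln (?f y) <
      u * (ln (?f z) + (?f x - ?f z) / ?f z) + v * (ln (?f z) + (?f y - ?f z) / ?f z)"
    using * \<gamma> one_plus_pos \<open>0 \<le> z\<close>
    by (intro add_strict_mono mult_strict_left_mono ln_less_tangent) auto
  also have "\<dots> = (u + v) * ln (?f z) + (u * (?f x - ?f z) + v * (?f y - ?f z)) / ?f z"
    by (simp add: distrib_left distrib_right add_divide_distrib)
  also have "u * (?f x - ?f z) + v * (?f y - ?f z) = 0"
    by (simp add: z_def v algebra_simps)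
  finally show "u * awgn x + v * awgn y < awgn (u * x + v * y)"
    using * by (simp add: awgn_def z_def)
qed simp

lemma concave_reward_awgn: "concave_reward awgn"
proof
  have mono: "mono_on {0..} awgn"
  proof (rule mono_onI)
    fix x y :: real assume "x \<in> {0..}" "x \<le> y"
    then show "awgn x \<le> awgn y"
      using \<gamma> one_plus_pos[of x] one_plus_pos[of y] by (simp add: awgn_def)
  qed
  \<comment> \<open>The slope is steepest at 0, where it equals \<open>\<gamma> / 2\<close>.\<close>
  have le: "awgn y - awgn x \<le> \<gamma> / 2 * (y - x)" if "0 \<le> x" "x \<le> y" for x y
  proof (cases "x = y")
    case False
    have "ln (1 + \<gamma> * y) - ln (1 + \<gamma> * x) \<le> \<gamma> * (y - x) / (1 + \<gamma> * x)"
      using ln_less_tangent[of "1 + \<gamma> * y" "1 + \<gamma> * x"] one_plus_pos[of x] one_plus_pos[of y] that False \<gamma>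
      by (simp add: algebra_simps)
    also have "\<dots> \<le> \<gamma> * (y - x)"
      using that \<gamma> one_plus_pos[of x] mult_left_mono[of 1 "1 + \<gamma> * x" "\<gamma> * (y - x)"]
      by (simp add: pos_divide_le_eq)
    finally show ?thesis by (simp add: awgn_def)
  qed simp
  have "(\<gamma> / 2)-lipschitz_on {0..} awgn"
  proof (rule lipschitz_onI)
    fix x y :: real assume "x \<in> {0..}" "y \<in> {0..}"
    then show "dist (awgn x) (awgn y) \<le> \<gamma> / 2 * dist x y"
      using le[of x y] le[of y x] mono_onD[OF mono, of x y] mono_onD[OF mono, of y x]
      by (cases "x \<le> y") (auto simp: dist_real_def)
  qed (use \<gamma> in simp)
  moreover have "concave_on {0..} awgn"
    unfolding concave_on_iff
  proof (intro conjI ballI allI impI)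
    fix x y u v :: real
    assume *: "x \<in> {0..}" "y \<in> {0..}" "0 \<le> u" "0 \<le> v" "u + v = 1"
    show "u * awgn x + v * awgn y \<le> awgn (u *\<^sub>R x + v *\<^sub>R y)"
    proof (cases "x = y \<or> u = 0 \<or> v = 0")
      case True
      then show ?thesis using * by (auto simp flip: distrib_right)
    next
      case False
      then show ?thesis
        using strictly_concave_awgn[unfolded strictly_concave_on_def, THEN conjunct2, rule_format, of x y u v] *
        by simp
    qed
  qed simp
  ultimately show "reward_function awgn"
    unfolding reward_function_def using mono mono_onD[OF mono, of 0] by (auto simp: awgn_def)
  show "awgn differentiable_on {0..}"
    unfolding differentiable_on_def
    using awgn_has_derivative by (auto simp: real_differentiable_def)
qed (rule strictly_concave_awgn)

section \<open>Closed form of the optimal rule for the logarithmic reward\<close>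

context
  fixes p :: real
  assumes p: "0 < p" "p < 1"
begin

interpretation discounted_reward awgn p
  using concave_reward_awgn p by (simp add: discounted_reward_def discounted_reward_axioms_def)

text \<open>The two bounds say that \<open>(1 + \<gamma> * x) * q ^ k - 1\<close> is nonnegative for
  \<open>k < m\<close> and nonpositive at \<open>k = m\<close>. The first \<open>m\<close> shares
  are these numbers over \<open>\<gamma>\<close>, and their sum is geometric.\<close>

lemma eta_awgn:
  assumes "0 \<le> x" "0 < m" "1 \<le> (1 + \<gamma> * x) * q ^ (m - 1)" "(1 + \<gamma> * x) * q ^ m \<le> 1"
  shows "eta awgn p x = ((1 + \<gamma> * x) * (1 - q ^ m) / p - real m) / \<gamma>"
proof -
  have pos: "0 < 1 + \<gamma> * x" by (rule one_plus_pos) fact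
  have share: "share k x = ((1 + \<gamma> * x) * q ^ k - 1) / \<gamma>" if "k < m" for k
  proof (rule share_eqI)
    let ?u = "((1 + \<gamma> * x) * q ^ k - 1) / \<gamma>"
    have "(1 + \<gamma> * x) * q ^ (m - 1) \<le> (1 + \<gamma> * x) * q ^ k"
      using that pos p by (intro mult_left_mono power_decreasing) auto
    then have ge: "1 \<le> (1 + \<gamma> * x) * q ^ k" using assms(3) by linarith
    then show u: "0 \<le> ?u" using \<gamma> by simp
    have "rderiv awgn ?u = \<gamma> / (2 * ((1 + \<gamma> * x) * q ^ k))"
      using \<gamma> unfolding rderiv_awgn[OF u] by simp
    also have "\<dots> = rderiv awgn x / q ^ k"
      using assms(1) by (simp add: rderiv_awgn)
    finally show "rderiv awgn ?u = min (rderiv awgn 0) (rderiv awgn x / q ^ k)"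
      using rderiv_antimono[of 0 ?u] u by simp
  qed
  have "q ^ m \<le> 1 / (1 + \<gamma> * x)"
    using assms(4) pos by (simp add: pos_le_divide_eq mult.commute)
  then have "q ^ m * (\<gamma> / 2) \<le> 1 / (1 + \<gamma> * x) * (\<gamma> / 2)"
    using \<gamma> by (intro mult_right_mono) auto
  then have "q ^ m * rderiv awgn 0 \<le> rderiv awgn x"
    using assms(1) by (simp add: rderiv_awgn mult.commute)
  then have "eta awgn p x = (\<Sum>k<m. ((1 + \<gamma> * x) * q ^ k - 1) / \<gamma>)"
    using eta_eq_sum_share[OF assms(1)] share by simp
  also have "\<dots> = ((1 + \<gamma> * x) * (\<Sum>k<m. q ^ k) - real m) / \<gamma>"
    by (simp add: sum_subtractf sum_distrib_left flip: sum_divide_distrib)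
  also have "(\<Sum>k<m. q ^ k) = (1 - q ^ m) / p"
    using p by (simp add: sum_gp_strict)
  finally show ?thesis by simp
qed

lemma M_awgn_props:
  fixes y :: real
  defines "m \<equiv> M_awgn \<gamma> p y"
  shows "0 < m" "(1 + p * (\<gamma> * y + real m)) * q ^ m < 1"
    "1 < m \<Longrightarrow> 1 \<le> (1 + p * (\<gamma> * y + real (m - 1))) * q ^ (m - 1)"
proof -
  let ?P = "\<lambda>m. 0 < m \<and> (1 + p * (\<gamma> * y + real m)) * q ^ m < 1"
  \<comment> \<open>Since \<open>m * q ^ m\<close> tends to 0, some positive \<open>m\<close>
    satisfies the condition, so \<open>LEAST\<close> is not a junk value.\<close>
  have "(\<lambda>m. (1 + p * \<gamma> * y) * q ^ m + p * (real m * q ^ m)) \<longlonglongrightarrow> (1 + p * \<gamma> * y) * 0 + p * 0"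
    using p by (intro tendsto_intros powser_times_n_limit_0 LIMSEQ_power_zero) auto
  then have "\<forall>\<^sub>F m in sequentially. (1 + p * \<gamma> * y) * q ^ m + p * (real m * q ^ m) < 1"
    by (intro order_tendstoD) auto
  then have "\<forall>\<^sub>F m in sequentially. ?P m"
    using eventually_gt_at_top[of "0::nat"] by eventually_elim (simp add: algebra_simps)
  then obtain m' where "?P m'"
    using eventually_happens'[OF sequentially_bot] by blast
  then have "?P m"
    unfolding m_def M_awgn_def by (rule LeastI)
  then show "0 < m" "(1 + p * (\<gamma> * y + real m)) * q ^ m < 1" by auto
  assume "1 < m"
  then have "\<not> ?P (m - 1)"
    unfolding m_def M_awgn_def by (intro not_less_Least) simp
  then show "1 \<le> (1 + p * (\<gamma> * y + real (m - 1))) * q ^ (m - 1)"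
    using \<open>1 < m\<close> by simp
qed

text \<open>The formula solves \<open>eta awgn p x = y\<close> with \<open>m\<close> terms. The
  defining inequality of \<open>M_awgn\<close> and its failure at \<open>m - 1\<close> become the
  two bounds required by \<open>eta_awgn\<close>.\<close>

lemma omega_awgn_eq_omega:
  assumes "0 \<le> y"
  shows "omega_awgn \<gamma> p y = omega awgn p y"
proof -
  define m where "m = M_awgn \<gamma> p y"
  define x where "x = omega_awgn \<gamma> p y"
  note m = M_awgn_props[of y, folded m_def]
  have qm: "q ^ m < 1" using m(1) p by (simp add: power_less_one_iff)
  have x: "1 + \<gamma> * x = p * (\<gamma> * y + real m) / (1 - q ^ m)"
    unfolding x_def omega_awgn_def m_def[symmetric] using \<gamma> by simp
  then have x': "(1 + \<gamma> * x) * (1 - q ^ m) = p * (\<gamma> * y + real m)"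
    using qm by simp
  have upper: "(1 + \<gamma> * x) * q ^ m \<le> 1"
    using m(2) qm by (simp add: x field_simps)
  have lower: "1 \<le> (1 + \<gamma> * x) * q ^ (m - 1)"
  proof (cases "m = 1")
    case True
    \<comment> \<open>For \<open>m = 1\<close> minimality says nothing, but then
      \<open>x = y\<close>.\<close>
    then show ?thesis
      using x' p \<gamma> assms by simp
  next
    case False
    then have "1 < m" using m(1) by simp
    then obtain k where k: "m = Suc k" by (cases m) auto
    \<comment> \<open>Minimality at \<open>m - 1\<close>, with \<open>p * q ^ (m - 1)\<close> added
      to both sides.\<close>
    have "1 - q ^ m \<le> p * (\<gamma> * y + real m) * q ^ (m - 1)"
      using m(3)[OF \<open>1 < m\<close>] by (simp add: k algebra_simps)
    then show ?thesis
      using qm by (simp add: x field_simps)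
  qed
  have "0 \<le> x"
  proof -
    have "q ^ (m - 1) \<le> 1" "0 < q ^ (m - 1)" using p by (auto intro: power_le_one)
    moreover have "0 < 1 + \<gamma> * x"
      using lower \<open>0 < q ^ (m - 1)\<close> by (metis not_less zero_less_mult_pos2 zero_less_one order_less_le_trans)
    ultimately have "1 \<le> (1 + \<gamma> * x) * 1"
      using lower by (meson mult_left_mono order_trans less_imp_le)
    then show ?thesis using \<gamma> by (simp add: zero_le_mult_iff)
  qed
  then have "eta awgn p x = y"
    using eta_awgn[OF _ m(1) lower upper] p \<gamma> by (simp add: x')
  then show ?thesis
    using omega_eqI[OF \<open>0 \<le> x\<close>] by (simp add: x_def)
qed

lemma omega_awgn_optimal:
  assumes "0 < c"
  shows "is_stationary_rule c (omega_awgn \<gamma> p)"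
    and "maximin_optimal awgn c p (stationary_policy c (omega_awgn \<gamma> p))"
proof -
  show "is_stationary_rule c (omega_awgn \<gamma> p)"
    using is_stationary_rule_omega[of c] by (simp add: is_stationary_rule_def omega_awgn_eq_omega)
  obtain V where "bellman c p awgn V (omega_awgn \<gamma> p)"
    using ex_bellman[OF assms, of "omega_awgn \<gamma> p"] omega_awgn_eq_omega by auto
  then show "maximin_optimal awgn c p (stationary_policy c (omega_awgn \<gamma> p))"
    by (rule bellman.maximin_optimal_rule)
qed

end

end

theorem theorem5:
  fixes c p :: real
  assumes "c > 0" and "0 < p" and "p < 1"
  shows "(\<forall>r. regular_reward r \<longrightarrow>
            (\<forall>x\<ge>0. eta r p x =
               (\<Sum>i=1..nat (M_tilde r p x). kappa r (1 / (1 - p) ^ (i - 1)) x)) \<and>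
            (\<forall>y\<in>{0..c}. \<exists>!x. x \<in> {0..} \<and> eta r p x = y) \<and>
            is_stationary_rule c (omega r p) \<and>
            maximin_optimal r c p (stationary_policy c (omega r p)) \<and>
            scaled_bernoulli c p \<in> arrival_laws c p \<and>
            average_reward r (stationary_policy c (omega r p)) (iid_law (scaled_bernoulli c p)) =
              (INF Q\<in>arrival_laws c p.
                 average_reward r (stationary_policy c (omega r p)) (iid_law Q))) \<and>
         (\<forall>\<gamma>>0. is_stationary_rule c (omega_awgn \<gamma> p) \<and>
            maximin_optimal (\<lambda>u. 1 / 2 * ln (1 + \<gamma> * u)) c p
              (stationary_policy c (omega_awgn \<gamma> p)))"
proof (intro conjI allI impI)
  fix r assume "regular_reward r"
  then interpret discounted_reward r p
    using assms by unfold_locales (auto simp: regular_reward_def)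
  obtain V where "bellman c p r V (omega r p)"
    using ex_bellman[OF assms(1)] by blast
  then interpret bellman c p r V "omega r p" .
  show "eta r p x = (\<Sum>i=1..nat (M_tilde r p x). kappa r (1 / (1 - p) ^ (i - 1)) x)" if "0 \<le> x" for x
    using that by (rule eta_eq_sum_M_tilde)
  show "\<forall>y\<in>{0..c}. \<exists>!x. x \<in> {0..} \<and> eta r p x = y"
    using eta_bij_ex1 by simp
  show "is_stationary_rule c (omega r p)"
    by (rule is_stationary_rule_omega)
  show "maximin_optimal r c p (stationary_policy c (omega r p))"
    by (rule maximin_optimal_rule)
  show "scaled_bernoulli c p \<in> arrival_laws c p"
    using assms by (rule scaled_bernoulli_in_arrival_laws)
  show "average_reward r (stationary_policy c (omega r p)) (iid_law (scaled_bernoulli c p)) =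
      (INF Q\<in>arrival_laws c p. average_reward r (stationary_policy c (omega r p)) (iid_law Q))"
    using worst_case_reward_rule average_reward_rule_bernoulli by (simp add: worst_case_reward_def)
next
  fix \<gamma> :: real assume "0 < \<gamma>"
  note optimal = omega_awgn_optimal[OF this assms(2,3,1), unfolded awgn_def[OF \<open>0 < \<gamma>\<close>, abs_def]]
  show "is_stationary_rule c (omega_awgn \<gamma> p)"
    by (rule optimal)
  show "maximin_optimal (\<lambda>u. 1 / 2 * ln (1 + \<gamma> * u)) c p (stationary_policy c (omega_awgn \<gamma> p))"
    by (rule optimal)
qed

end
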